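(* Let $G$ be a finitely generated group with $\operatorname{asdim}G\le n$, let $A$ be a subgroup of $G$, let $\phi:A\to G$ be a monomorphism, and let $G'$ be the HNN extension of $G$ by means of $\phi$. Then $\operatorname{asdim}G'\le 2n+1$.
   Context: Two sets $U_1,U_2$ in a metric space are $d$-disjoint if $\inf\{\operatorname{dist}(x_1,x_2)\mid x_1\in U_1,\ x_2\in U_2\}\ge d$; a family of sets is $d$-disjoint if any two distinct members are. A metric space $X$ satisfies $\operatorname{asdim}X\le n$ if for every (arbitrarily large) $d>0$ there are $n+1$ uniformly bounded $d$-disjoint families of subsets of $X$ whose union covers $X$ (uniformly bounded: diameters bounded by a common constant). A finitely generated group $\Gamma$ carries the left-invariant word metric $d_S(x,y)$ = the word length of $x^{-1}y$ with respect to a finite generating set $S$; $\operatorname{asdim}\Gamma$ means $\operatorname{asdim}(\Gamma,d_S)$, which does not depend on $S$. The HNN extension of $G$ by means of $\phi:A\to G$ is the group $G'$ generated by $G$ and an additional element $y$ subject to the relations of $G$ and $yay^{-1}=\phi(a)$ for all $a\in A$. *)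

theory Defs
  imports "HOL-Algebra.Generated_Groups" "HOL-Library.Extended_Real"
begin

section \<open>Asymptotic dimension\<close>

text \<open>The infimum is taken in the extended reals, so that it is \<^term>\<open>\<infinity>\<close> when one of
  the two sets is empty.\<close>

definition d_disjoint :: "('a \<Rightarrow> 'a \<Rightarrow> real) \<Rightarrow> real \<Rightarrow> 'a set \<Rightarrow> 'a set \<Rightarrow> bool" where
  "d_disjoint \<delta> d U V \<longleftrightarrow> ereal d \<le> (INF (x, y) \<in> U \<times> V. ereal (\<delta> x y))"

definition d_disjoint_family :: "('a \<Rightarrow> 'a \<Rightarrow> real) \<Rightarrow> real \<Rightarrow> 'a set set \<Rightarrow> bool" where
  "d_disjoint_family \<delta> d \<U> \<longleftrightarrow> pairwise (d_disjoint \<delta> d) \<U>"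

definition uniformly_bounded_family :: "('a \<Rightarrow> 'a \<Rightarrow> real) \<Rightarrow> 'a set set \<Rightarrow> bool" where
  "uniformly_bounded_family \<delta> \<U> \<longleftrightarrow> (\<exists>D. \<forall>U\<in>\<U>. \<forall>x\<in>U. \<forall>y\<in>U. \<delta> x y \<le> D)"

definition asdim_le :: "'a set \<Rightarrow> ('a \<Rightarrow> 'a \<Rightarrow> real) \<Rightarrow> nat \<Rightarrow> bool" where
  "asdim_le X \<delta> n \<longleftrightarrow>
     (\<forall>d>0. \<exists>\<U> :: nat \<Rightarrow> 'a set set.
        (\<forall>i\<le>n. \<U> i \<subseteq> Pow X \<and> uniformly_bounded_family \<delta> (\<U> i) \<and> d_disjoint_family \<delta> d (\<U> i)) \<and>
        X \<subseteq> (\<Union>i\<le>n. \<Union>(\<U> i)))"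


section \<open>Word metrics\<close>

definition finite_generating_set :: "('a, 'b) monoid_scheme \<Rightarrow> 'a set \<Rightarrow> bool" where
  "finite_generating_set G S \<longleftrightarrow> finite S \<and> S \<subseteq> carrier G \<and> generate G S = carrier G"

definition word_length :: "('a, 'b) monoid_scheme \<Rightarrow> 'a set \<Rightarrow> 'a \<Rightarrow> nat" where
  "word_length G S g =
     (LEAST k. \<exists>ws. length ws = k \<and> set ws \<subseteq> S \<union> (\<lambda>s. inv\<^bsub>G\<^esub> s) ` S \<and>
                    foldr (\<lambda>a b. a \<otimes>\<^bsub>G\<^esub> b) ws \<one>\<^bsub>G\<^esub> = g)"

definition word_metric :: "('a, 'b) monoid_scheme \<Rightarrow> 'a set \<Rightarrow> 'a \<Rightarrow> 'a \<Rightarrow> real" where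
  "word_metric G S x y = real (word_length G S (inv\<^bsub>G\<^esub> x \<otimes>\<^bsub>G\<^esub> y))"


section \<open>Groups given by generators and relations\<close>

text \<open>The letter \<open>(x, True)\<close> stands for the generator \<open>x\<close>, and \<open>(x, False)\<close> for its
  formal inverse.  A relation is a pair of words that are to become equal.\<close>

type_synonym 'x gword = "('x \<times> bool) list"

definition gwords :: "'x set \<Rightarrow> 'x gword set" where
  "gwords X = lists (X \<times> UNIV)"

inductive pres_eq :: "'x set \<Rightarrow> ('x gword \<times> 'x gword) set \<Rightarrow> 'x gword \<Rightarrow> 'x gword \<Rightarrow> bool"
  for X R where
  refl: "u \<in> gwords X \<Longrightarrow> pres_eq X R u u"
| sym: "pres_eq X R u v \<Longrightarrow> pres_eq X R v u"
| trans: "pres_eq X R u v \<Longrightarrow> pres_eq X R v w \<Longrightarrow> pres_eq X R u w"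
| cancel: "p \<in> gwords X \<Longrightarrow> q \<in> gwords X \<Longrightarrow> x \<in> X \<Longrightarrow>
     pres_eq X R (p @ [(x, b), (x, \<not> b)] @ q) (p @ q)"
| relation: "p \<in> gwords X \<Longrightarrow> q \<in> gwords X \<Longrightarrow> (u, v) \<in> R \<Longrightarrow> u \<in> gwords X \<Longrightarrow> v \<in> gwords X \<Longrightarrow>
     pres_eq X R (p @ u @ q) (p @ v @ q)"

definition pres_rel :: "'x set \<Rightarrow> ('x gword \<times> 'x gword) set \<Rightarrow> ('x gword \<times> 'x gword) set" where
  "pres_rel X R = {(u, v). pres_eq X R u v}"

definition presented_group :: "'x set \<Rightarrow> ('x gword \<times> 'x gword) set \<Rightarrow> 'x gword set monoid" where
  "presented_group X R =
     \<lparr>carrier = gwords X // pres_rel X R,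
      mult = (\<lambda>U V. pres_rel X R `` {u @ v | u v. u \<in> U \<and> v \<in> V}),
      one = pres_rel X R `` {[]}\<rparr>"


section \<open>HNN extensions\<close>

datatype 'a hnn_gen = Base 'a | Stable

definition hnn_gens :: "('a, 'b) monoid_scheme \<Rightarrow> 'a hnn_gen set" where
  "hnn_gens G = insert Stable (Base ` carrier G)"

text \<open>The relations of \<open>G\<close> are given by its multiplication table; \<^const>\<open>Stable\<close> is the
  additional generator \<open>y\<close>.\<close>

definition hnn_rels ::
  "('a, 'b) monoid_scheme \<Rightarrow> 'a set \<Rightarrow> ('a \<Rightarrow> 'a) \<Rightarrow> ('a hnn_gen gword \<times> 'a hnn_gen gword) set" where
  "hnn_rels G A \<phi> =
     {([(Base g, True), (Base h, True)], [(Base (g \<otimes>\<^bsub>G\<^esub> h), True)]) | g h.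
        g \<in> carrier G \<and> h \<in> carrier G} \<union>
     {([(Stable, True), (Base a, True), (Stable, False)], [(Base (\<phi> a), True)]) | a. a \<in> A}"

definition HNN_extension ::
  "('a, 'b) monoid_scheme \<Rightarrow> 'a set \<Rightarrow> ('a \<Rightarrow> 'a) \<Rightarrow> 'a hnn_gen gword set monoid" where
  "HNN_extension G A \<phi> = presented_group (hnn_gens G) (hnn_rels G A \<phi>)"

end

theory Submission
  imports Defs
begin

text \<open>The HNN extension acts on its Bass-Serre tree, and the bound is the product bound for this
  action: the tree can be coloured with two colours, the part of the group that lies over a
  bounded piece of the tree with \<open>n + 1\<close> colours, and the pairs of colours number
  \<open>2 (n + 1) = (2 n + 1) + 1\<close>.

  Covers by disjoint families are replaced by colourings: \<open>asdim X \<le> n\<close> means that for every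
  scale \<open>r\<close> the points can be given colours \<open>0, \<dots>, n\<close> such that every one-coloured chain of steps of
  length at most \<open>r\<close> stays bounded (\<open>colourable_if_asdim_le\<close>, \<open>asdim_le_if_colourable\<close>).
  Colourings are easily pulled back along coarse maps (\<open>colourable_piecewise\<close>), and a union of two
  sets is no worse than its pieces (\<open>colourable_union\<close>).

  The tree enters through normal forms.  Every element is uniquely
  \<open>t\<^sub>1 y\<^bsup>e\<^sub>1\<^esup> \<dots> t\<^sub>k y\<^bsup>e\<^sub>k\<^esup> g\<close> with coset representatives \<open>t\<^sub>i\<close>, without cancellation, and \<open>g \<in> G\<close>; the list of
  the pairs \<open>(t\<^sub>i, e\<^sub>i)\<close> is the path in the tree from the root \<open>G\<close> to the coset of the element.
  Multiplication on the right by an element of \<open>G\<close> keeps the list, and multiplication by \<open>y\<close> or its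
  inverse adds or removes one entry at the end.  Existence and uniqueness come from letting words
  act on normal forms (\<open>word_act_cong\<close>, \<open>nf_value_nf\<close>); in particular \<open>G\<close> embeds, so that its
  dimension can be measured in the metric of the extension (\<open>colourable_subgroup\<close>).

  The elements with at most \<open>R\<close> list entries have dimension at most \<open>n\<close>, by induction on \<open>R\<close>
  (\<open>colourable_levels\<close>): the elements at level \<open>R + 1\<close> form cosets of \<open>G\<close>, and a path between two of these cosets
  passes through a lower level (\<open>crossing\<close>), so away from the lower levels the cosets are far apart.
  Finally the tree is cut into annuli, coloured alternately (\<open>colourable_tree\<close>).  A short-step chain
  that stays in one annulus keeps its ancestor a few levels closer to the root, again by \<open>crossing\<close>,
  hence lies in a left translate of the elements of some bounded level.\<close>

section \<open>Asymptotic dimension by colourings\<close>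

text \<open>Chains of such steps take the place of the members of a disjoint family.  Unlike the families
  themselves they can be followed by induction through maps and unions.\<close>

definition monochrome :: "('a \<Rightarrow> 'a \<Rightarrow> real) \<Rightarrow> 'a set \<Rightarrow> real \<Rightarrow> ('a \<Rightarrow> nat) \<Rightarrow> ('a \<times> 'a) set" where
  "monochrome \<delta> X r c = {(x, y). x \<in> X \<and> y \<in> X \<and> c x = c y \<and> \<delta> x y \<le> r}"

definition colouring :: "('a \<Rightarrow> 'a \<Rightarrow> real) \<Rightarrow> 'a set \<Rightarrow> nat \<Rightarrow> real \<Rightarrow> ('a \<Rightarrow> nat) \<Rightarrow> real \<Rightarrow> bool" where
  "colouring \<delta> X n r c D \<longleftrightarrow>
     (\<forall>x\<in>X. c x \<le> n) \<and> (\<forall>x\<in>X. \<forall>y. (x, y) \<in> (monochrome \<delta> X r c)\<^sup>* \<longrightarrow> \<delta> x y \<le> D)"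

definition colourable :: "('a \<Rightarrow> 'a \<Rightarrow> real) \<Rightarrow> 'a set \<Rightarrow> nat \<Rightarrow> real \<Rightarrow> bool" where
  "colourable \<delta> X n r \<longleftrightarrow> (\<exists>c D. colouring \<delta> X n r c D)"

lemma colouring_bound:
  "colouring \<delta> X n r c D \<Longrightarrow> x \<in> X \<Longrightarrow> (x, y) \<in> (monochrome \<delta> X r c)\<^sup>* \<Longrightarrow> \<delta> x y \<le> D"
  by (auto simp: colouring_def)

lemma colouring_mono: "colouring \<delta> X n r c D \<Longrightarrow> D \<le> D' \<Longrightarrow> colouring \<delta> X n r c D'"
  unfolding colouring_def by (meson order_trans)

lemma colourable_scale_mono:
  assumes "colourable \<delta> X n r'" "r \<le> r'"
  shows "colourable \<delta> X n r"
proof -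
  have "monochrome \<delta> X r c \<subseteq> monochrome \<delta> X r' c" for c
    using assms(2) by (auto simp: monochrome_def)
  then have "(monochrome \<delta> X r c)\<^sup>* \<subseteq> (monochrome \<delta> X r' c)\<^sup>*" for c by (rule rtrancl_mono)
  then show ?thesis using assms(1) unfolding colourable_def colouring_def by blast
qed

lemma colourable_nonneg:
  assumes "colourable \<delta> X n r"
  obtains c D where "colouring \<delta> X n r c D" "0 \<le> D"
proof -
  obtain c D where "colouring \<delta> X n r c D" using assms by (auto simp: colourable_def)
  then have "colouring \<delta> X n r c (max 0 D)" by (rule colouring_mono) simp
  then show thesis by (rule that) simp
qed

lemma chain_in:
  "(x, y) \<in> (monochrome \<delta> X r c)\<^sup>* \<Longrightarrow> x \<in> X \<Longrightarrow> y \<in> X \<and> c y = c x"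
  by (induction rule: rtrancl_induct) (auto simp: monochrome_def)

text \<open>A family that is \<open>d\<close>-disjoint for some \<open>d > r\<close> is never left by a step of length \<open>r\<close>: a point gets as its
  colour the number of a family that covers it, and a one-coloured chain is then confined to the
  member in which it starts.\<close>

lemma colourable_if_asdim_le:
  assumes "asdim_le X \<delta> n"
  shows "colourable \<delta> X n r"
proof -
  \<comment> \<open>Strictly larger than \<open>r\<close>, and positive also for negative \<open>r\<close>.\<close>
  define d where "d = max r 0 + 1"
  have d: "d > 0" "r < d" by (auto simp: d_def)
  obtain \<U> :: "nat \<Rightarrow> 'a set set" where
    all: "\<forall>i\<le>n. \<U> i \<subseteq> Pow X \<and> uniformly_bounded_family \<delta> (\<U> i) \<and> d_disjoint_family \<delta> d (\<U> i)"
    and cover: "X \<subseteq> (\<Union>i\<le>n. \<Union>(\<U> i))"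
    using assms[unfolded asdim_le_def, rule_format, OF d(1)] by (elim exE conjE) (rule that)
  have U: "\<And>i. i \<le> n \<Longrightarrow> uniformly_bounded_family \<delta> (\<U> i)"
       "\<And>i. i \<le> n \<Longrightarrow> d_disjoint_family \<delta> d (\<U> i)"
    using all by simp_all
  have "\<forall>i\<in>{..n}. \<exists>D. \<forall>U\<in>\<U> i. \<forall>x\<in>U. \<forall>y\<in>U. \<delta> x y \<le> D"
    using U(1) by (auto simp: uniformly_bounded_family_def)
  then obtain D where D: "\<And>i U x y. i \<le> n \<Longrightarrow> U \<in> \<U> i \<Longrightarrow> x \<in> U \<Longrightarrow> y \<in> U \<Longrightarrow> \<delta> x y \<le> D i"
    by (metis atMost_iff)
  define c where "c x = (SOME i. i \<le> n \<and> x \<in> \<Union>(\<U> i))" for x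
  have c: "c x \<le> n \<and> x \<in> \<Union>(\<U> (c x))" if "x \<in> X" for x
    unfolding c_def by (rule someI_ex) (use cover that in blast)
  have stay: "y \<in> U" if "(x, y) \<in> (monochrome \<delta> X r c)\<^sup>*" "x \<in> X" "U \<in> \<U> (c x)" "x \<in> U" for x y U
    using that
  proof (induction rule: rtrancl_induct)
    case (step y z)
    then have y: "y \<in> U" by simp
    have "y \<in> X" "c y = c x" using chain_in[OF step(1)] step.prems by auto
    then have yz: "c z = c x" "z \<in> X" "\<delta> y z \<le> r" using step(2) by (auto simp: monochrome_def)
    then obtain V where V: "V \<in> \<U> (c x)" "z \<in> V" using c[of z] by auto
    show "z \<in> U"
    proof (rule ccontr)
      assume "z \<notin> U"
      then have "U \<noteq> V" using V by auto
      then have "d_disjoint \<delta> d U V"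
        using U(2)[of "c x"] c[of x] step.prems V unfolding d_disjoint_family_def pairwise_def by blast
      moreover have "(y, z) \<in> U \<times> V" using y V by simp
      ultimately have "ereal d \<le> ereal (\<delta> y z)"
        unfolding d_disjoint_def le_INF_iff by fastforce
      then show False using yz(3) d(2) by simp
    qed
  qed simp
  have "colouring \<delta> X n r c (Max (D ` {..n}))"
    unfolding colouring_def
  proof (intro conjI ballI allI impI)
    fix x y assume x: "x \<in> X" and ch: "(x, y) \<in> (monochrome \<delta> X r c)\<^sup>*"
    obtain U where U: "U \<in> \<U> (c x)" "x \<in> U" using c[OF x] by auto
    have "\<delta> x y \<le> D (c x)" using D[OF _ U(1,2)] stay[OF ch x U] c[OF x] by auto
    also have "\<dots> \<le> Max (D ` {..n})" using c[OF x] by (intro Max_ge) auto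
    finally show "\<delta> x y \<le> Max (D ` {..n})" .
  qed (use c in auto)
  then show ?thesis by (auto simp: colourable_def)
qed

text \<open>The members of the \<open>i\<close>-th family are the chain components of the points of colour \<open>i\<close>.\<close>

lemma asdim_le_if_colourable:
  assumes sym: "\<And>x y. x \<in> X \<Longrightarrow> y \<in> X \<Longrightarrow> \<delta> x y = \<delta> y x"
    and col: "\<And>r. colourable \<delta> X n r"
  shows "asdim_le X \<delta> n"
  unfolding asdim_le_def
proof (intro allI impI)
  fix d :: real assume "d > 0"
  obtain c D where c: "colouring \<delta> X n d c D" using col[of d] by (auto simp: colourable_def)
  let ?R = "monochrome \<delta> X d c"
  have "sym ?R" by (auto simp: sym_def monochrome_def sym)
  then have symR: "sym (?R\<^sup>*)" by (rule sym_rtrancl)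
  define \<U> where "\<U> i = {?R\<^sup>* `` {x} | x. x \<in> X \<and> c x = i}" for i
  have "\<U> i \<subseteq> Pow X" for i
    by (auto simp: \<U>_def dest: chain_in)
  moreover have "uniformly_bounded_family \<delta> (\<U> i)" for i
    unfolding uniformly_bounded_family_def
  proof (intro exI ballI)
    fix U x y assume "U \<in> \<U> i" "x \<in> U" "y \<in> U"
    then obtain z where z: "z \<in> X" "(z, x) \<in> ?R\<^sup>*" "(z, y) \<in> ?R\<^sup>*" by (auto simp: \<U>_def)
    then have "(x, y) \<in> ?R\<^sup>*" using symR by (meson rtrancl_trans symD)
    then show "\<delta> x y \<le> D" using colouring_bound[OF c] chain_in[OF z(2,1)] by blast
  qed
  moreover have "d_disjoint_family \<delta> d (\<U> i)" for i
    unfolding d_disjoint_family_def pairwise_def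
  proof (intro ballI impI)
    fix U V assume "U \<in> \<U> i" "V \<in> \<U> i" and ne: "U \<noteq> V"
    then obtain x y where x: "x \<in> X" "c x = i" "U = ?R\<^sup>* `` {x}"
      and y: "y \<in> X" "c y = i" "V = ?R\<^sup>* `` {y}" by (auto simp: \<U>_def)
    have "d \<le> \<delta> u v" if "u \<in> U" "v \<in> V" for u v
    proof (rule ccontr)
      assume less: "\<not> d \<le> \<delta> u v"
      have xu: "(x, u) \<in> ?R\<^sup>*" and yv: "(y, v) \<in> ?R\<^sup>*" using that x y by auto
      then have "(u, v) \<in> ?R"
        using chain_in[OF xu x(1)] chain_in[OF yv y(1)] x y less by (auto simp: monochrome_def)
      then have "(x, y) \<in> ?R\<^sup>*"
        using xu yv symR by (meson rtrancl_trans symD r_into_rtrancl)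
      then have "U = V" unfolding x y using symR by (auto intro: rtrancl_trans dest: symD)
      then show False using ne by simp
    qed
    then show "d_disjoint \<delta> d U V" by (auto simp: d_disjoint_def le_INF_iff)
  qed
  moreover have "X \<subseteq> (\<Union>i\<le>n. \<Union>(\<U> i))"
  proof
    fix x assume x: "x \<in> X"
    then have "x \<in> \<Union>(\<U> (c x))" by (auto simp: \<U>_def)
    moreover have "c x \<le> n" using c x by (auto simp: colouring_def)
    ultimately show "x \<in> (\<Union>i\<le>n. \<Union>(\<U> i))" by blast
  qed
  ultimately show "\<exists>\<U>. (\<forall>i\<le>n. \<U> i \<subseteq> Pow X \<and> uniformly_bounded_family \<delta> (\<U> i) \<and>
      d_disjoint_family \<delta> d (\<U> i)) \<and> X \<subseteq> (\<Union>i\<le>n. \<Union>(\<U> i))"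
    by blast
qed

text \<open>A colouring is pulled back along a map that is a coarse embedding on each piece of a
  partition (the fibres of \<open>lab\<close>), since no chain leaves the piece in which it starts.  The bounds are
  common to all pieces, but each piece may be moved to \<open>Y\<close> by its own translation.\<close>

lemma colourable_piecewise:
  assumes f: "\<And>x. x \<in> X \<Longrightarrow> f x \<in> Y"
    and label: "\<And>x y. x \<in> X \<Longrightarrow> y \<in> X \<Longrightarrow> \<delta> x y \<le> r \<Longrightarrow> lab x = lab y"
    and expand: "\<And>x y. x \<in> X \<Longrightarrow> y \<in> X \<Longrightarrow> lab x = lab y \<Longrightarrow> \<delta> x y \<le> r \<Longrightarrow> \<delta>' (f x) (f y) \<le> r'"
    and proper: "\<And>D. \<exists>D'. \<forall>x\<in>X. \<forall>y\<in>X. lab x = lab y \<longrightarrow> \<delta>' (f x) (f y) \<le> D \<longrightarrow> \<delta> x y \<le> D'"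
    and col: "colourable \<delta>' Y n r'"
  shows "colourable \<delta> X n r"
proof -
  obtain c D where c: "colouring \<delta>' Y n r' c D" using col by (auto simp: colourable_def)
  obtain D' where D': "\<And>x y. x \<in> X \<Longrightarrow> y \<in> X \<Longrightarrow> lab x = lab y \<Longrightarrow> \<delta>' (f x) (f y) \<le> D \<Longrightarrow> \<delta> x y \<le> D'"
    using proper[of D] by blast
  have chain: "(f x, f y) \<in> (monochrome \<delta>' Y r' c)\<^sup>* \<and> lab x = lab y \<and> y \<in> X"
    if "(x, y) \<in> (monochrome \<delta> X r (c \<circ> f))\<^sup>*" "x \<in> X" for x y
    using that
  proof (induction rule: rtrancl_induct)
    case (step y z)
    then have yz: "y \<in> X" "z \<in> X" "c (f y) = c (f z)" "\<delta> y z \<le> r" by (auto simp: monochrome_def)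
    then have "lab y = lab z" using label by blast
    then have "(f y, f z) \<in> monochrome \<delta>' Y r' c" using yz f expand by (auto simp: monochrome_def)
    then show ?case using step \<open>lab y = lab z\<close> yz by auto
  qed simp
  have "colouring \<delta> X n r (c \<circ> f) D'"
    unfolding colouring_def
  proof (intro conjI ballI allI impI)
    fix x y assume x: "x \<in> X" and xy: "(x, y) \<in> (monochrome \<delta> X r (c \<circ> f))\<^sup>*"
    from chain[OF xy x] show "\<delta> x y \<le> D'"
      using D'[of x y] colouring_bound[OF c f[OF x]] x by blast
  qed (use c f in \<open>auto simp: colouring_def\<close>)
  then show ?thesis by (auto simp: colourable_def)
qed

text \<open>The colours of the two sets are kept apart, so that no chain passes from one set to the
  other.\<close>

lemma colourable_add:
  assumes "colourable \<delta> X n r" "colourable \<delta> Y m r" and disj: "X \<inter> Y = {}"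
  shows "colourable \<delta> (X \<union> Y) (n + m + 1) r"
proof -
  obtain c D where c: "colouring \<delta> X n r c D" using assms by (auto simp: colourable_def)
  obtain c' D' where c': "colouring \<delta> Y m r c' D'" using assms by (auto simp: colourable_def)
  define k where "k x = (if x \<in> X then c x else n + 1 + c' x)" for x
  have k: "k x \<le> n" if "x \<in> X" for x using c that by (auto simp: k_def colouring_def)
  have k': "n < k x \<and> k x \<le> n + m + 1" if "x \<in> Y" for x
    using c' that disj by (auto simp: k_def colouring_def)
  have inX: "(x, y) \<in> (monochrome \<delta> X r c)\<^sup>* \<and> y \<in> X"
    if "(x, y) \<in> (monochrome \<delta> (X \<union> Y) r k)\<^sup>*" "x \<in> X" for x y
    using that
  proof (induction rule: rtrancl_induct)
    case (step y z)
    then have y: "y \<in> X" "z \<in> X \<union> Y" "k z = k y" "\<delta> y z \<le> r" by (auto simp: monochrome_def)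
    then have "z \<in> X" using k k' by fastforce
    then have "(y, z) \<in> monochrome \<delta> X r c" using y by (auto simp: monochrome_def k_def)
    then show ?case using step \<open>z \<in> X\<close> by auto
  qed simp
  have inY: "(x, y) \<in> (monochrome \<delta> Y r c')\<^sup>* \<and> y \<in> Y"
    if "(x, y) \<in> (monochrome \<delta> (X \<union> Y) r k)\<^sup>*" "x \<in> Y" for x y
    using that
  proof (induction rule: rtrancl_induct)
    case (step y z)
    then have y: "y \<in> Y" "z \<in> X \<union> Y" "k z = k y" "\<delta> y z \<le> r" by (auto simp: monochrome_def)
    then have "z \<in> Y" using k k' by fastforce
    moreover have "y \<notin> X" "z \<notin> X" using y disj \<open>z \<in> Y\<close> by blast+
    ultimately have "(y, z) \<in> monochrome \<delta> Y r c'" using y by (simp add: monochrome_def k_def)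
    then show ?case using step \<open>z \<in> Y\<close> by auto
  qed simp
  have "colouring \<delta> (X \<union> Y) (n + m + 1) r k (max D D')"
    unfolding colouring_def
  proof (intro conjI ballI allI impI)
    fix x y assume "x \<in> X \<union> Y" and xy: "(x, y) \<in> (monochrome \<delta> (X \<union> Y) r k)\<^sup>*"
    then consider "x \<in> X" | "x \<in> Y" by blast
    then show "\<delta> x y \<le> max D D'"
      using inX[OF xy] inY[OF xy] colouring_bound[OF c] colouring_bound[OF c']
      by cases (meson max.coboundedI1 max.coboundedI2)+
  qed (use k k' in fastforce)
  then show ?thesis by (auto simp: colourable_def)
qed

locale pseudometric =
  fixes M :: "'a set" and \<delta> :: "'a \<Rightarrow> 'a \<Rightarrow> real"
  assumes self: "x \<in> M \<Longrightarrow> \<delta> x x = 0"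
    and commute: "x \<in> M \<Longrightarrow> y \<in> M \<Longrightarrow> \<delta> x y = \<delta> y x"
    and triangle: "x \<in> M \<Longrightarrow> y \<in> M \<Longrightarrow> z \<in> M \<Longrightarrow> \<delta> x z \<le> \<delta> x y + \<delta> y z"
begin

text \<open>Both sets use the same \<open>n + 1\<close> colours.  The set \<open>Z\<close> is coloured at scale \<open>r\<close>, with bound \<open>D1\<close> for
  its chains, and \<open>Y\<close> at a scale so large that a detour of a chain through \<open>Z\<close> is a single step for
  \<open>Y\<close>.  The visits of an \<open>r\<close>-chain to \<open>Y\<close> then form a chain in \<open>Y\<close>, and the rest of the chain stays
  close to them.\<close>

lemma colourable_union:
  assumes YM: "Y \<subseteq> M" and ZM: "Z \<subseteq> M" and disj: "Y \<inter> Z = {}" and r: "0 \<le> r"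
    and Y: "\<And>s. colourable \<delta> Y n s" and Z: "colourable \<delta> Z n r"
  shows "colourable \<delta> (Y \<union> Z) n r"
proof -
  obtain c1 D1 where c1: "colouring \<delta> Z n r c1 D1" and D1: "0 \<le> D1"
    using colourable_nonneg[OF Z] .
  \<comment> \<open>A detour through \<open>Z\<close>: a step into \<open>Z\<close>, a chain inside \<open>Z\<close>, and a step back.\<close>
  define r2 where "r2 = r + D1 + r"
  obtain c2 D2 where c2: "colouring \<delta> Y n r2 c2 D2" and D2: "0 \<le> D2"
    using colourable_nonneg[OF Y] .
  define c where "c x = (if x \<in> Y then c2 x else c1 x)" for x
  have cY: "c x = c2 x" if "x \<in> Y" for x using that by (simp add: c_def)
  have cZ: "c x = c1 x" if "x \<in> Z" for x using that disj by (auto simp: c_def)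
  let ?R = "monochrome \<delta> (Y \<union> Z) r c" and ?RZ = "monochrome \<delta> Z r c1" and ?RY = "monochrome \<delta> Y r2 c2"
  \<comment> \<open>Either the chain has not met \<open>Y\<close> yet, or \<open>u\<close> is its first and \<open>v\<close> its latest point in \<open>Y\<close>.\<close>
  have inv: "(x \<in> Z \<and> y \<in> Z \<and> (x, y) \<in> ?RZ\<^sup>*) \<or>
     (\<exists>u\<in>Y. \<exists>v\<in>Y. \<delta> x u \<le> D1 + r \<and> (u, v) \<in> ?RY\<^sup>* \<and> c v = c y \<and>
        (v = y \<or> (y \<in> Z \<and> (\<exists>z\<in>Z. \<delta> v z \<le> r \<and> (z, y) \<in> ?RZ\<^sup>*))))" (is "?I y")
    if "(x, y) \<in> ?R\<^sup>*" and x: "x \<in> Y \<union> Z" for x y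
    using that(1)
  proof (induction rule: rtrancl_induct)
    case base
    show ?case
    proof (cases "x \<in> Y")
      case True
      then have "\<delta> x x \<le> D1 + r" using self YM D1 r by auto
      with True show ?thesis by blast
    qed (use x in auto)
  next
    case (step y w)
    have yw: "y \<in> Y \<union> Z" "w \<in> Y \<union> Z" "c y = c w" "\<delta> y w \<le> r"
      using step(2) by (auto simp: monochrome_def)
    have zz: "(y, w) \<in> ?RZ" if "y \<in> Z" "w \<in> Z"
      using that yw cZ by (auto simp: monochrome_def)
    from step.IH show ?case
    proof (elim disjE conjE bexE)
      assume xy: "x \<in> Z" "y \<in> Z" "(x, y) \<in> ?RZ\<^sup>*"
      show ?case
      proof (cases "w \<in> Y")
        case True
        have "\<delta> x w \<le> \<delta> x y + \<delta> y w" using triangle xy True YM ZM by blast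
        also have "\<dots> \<le> D1 + r" using colouring_bound[OF c1 xy(1,3)] yw by simp
        finally show ?thesis using True by blast
      next
        case False
        then show ?thesis using xy zz yw by (meson UnE rtrancl.rtrancl_into_rtrancl)
      qed
    next
      fix u v assume uv: "u \<in> Y" "v \<in> Y" "\<delta> x u \<le> D1 + r" "(u, v) \<in> ?RY\<^sup>*" "c v = c y" and vy: "v = y"
      show ?case
      proof (cases "w \<in> Y")
        case True
        then have "(v, w) \<in> ?RY" using uv vy yw cY r D1 by (auto simp: monochrome_def r2_def)
        then have "(u, w) \<in> ?RY\<^sup>*" using uv(4) by (rule rtrancl_into_rtrancl[rotated])
        then show ?thesis using uv True by blast
      next
        case False
        then have "w \<in> Z" using yw by auto
        moreover have "\<delta> v w \<le> r" "c v = c w" using yw vy uv(5) by auto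
        ultimately show ?thesis using uv by blast
      qed
    next
      fix u v z assume uv: "u \<in> Y" "v \<in> Y" "\<delta> x u \<le> D1 + r" "(u, v) \<in> ?RY\<^sup>*" "c v = c y"
        and z: "y \<in> Z" "z \<in> Z" "\<delta> v z \<le> r" "(z, y) \<in> ?RZ\<^sup>*"
      have cvw: "c v = c w" using uv(5) yw by simp
      show ?case
      proof (cases "w \<in> Y")
        case True
        have "\<delta> v w \<le> \<delta> v z + \<delta> z w" "\<delta> z w \<le> \<delta> z y + \<delta> y w"
          using triangle uv z True YM ZM by blast+
        then have "\<delta> v w \<le> r2"
          using colouring_bound[OF c1 z(2,4)] z(3) yw(4) by (simp add: r2_def)
        then have "(v, w) \<in> ?RY" using uv True cvw cY by (auto simp: monochrome_def)
        then have "(u, w) \<in> ?RY\<^sup>*" using uv(4) by (rule rtrancl_into_rtrancl[rotated])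
        then show ?thesis using uv True by blast
      next
        case False
        then have w: "w \<in> Z" using yw by auto
        then have "(z, w) \<in> ?RZ\<^sup>*" using zz[OF z(1)] z(4) by (meson rtrancl_into_rtrancl)
        then show ?thesis using uv z w cvw by blast
      qed
    qed
  qed
  \<comment> \<open>From \<open>x\<close> to \<open>u\<close>, from \<open>u\<close> to \<open>v\<close>, and from \<open>v\<close> through \<open>Z\<close> to \<open>y\<close>.\<close>
  have "colouring \<delta> (Y \<union> Z) n r c (D1 + r + D2 + r + D1)"
    unfolding colouring_def
  proof (intro conjI ballI allI impI)
    fix x assume "x \<in> Y \<union> Z"
    then show "c x \<le> n" using c1 c2 cY cZ by (auto simp: colouring_def)
  next
    fix x y assume x: "x \<in> Y \<union> Z" and xy: "(x, y) \<in> ?R\<^sup>*"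
    have xM: "x \<in> M" and yM: "y \<in> M" using x chain_in[OF xy x] YM ZM by auto
    from inv[OF xy x] show "\<delta> x y \<le> D1 + r + D2 + r + D1"
    proof (elim disjE conjE bexE)
      assume "x \<in> Z" "(x, y) \<in> ?RZ\<^sup>*"
      then show ?thesis using colouring_bound[OF c1] D1 D2 r by fastforce
    next
      fix u v assume uv: "u \<in> Y" "v \<in> Y" "\<delta> x u \<le> D1 + r" "(u, v) \<in> ?RY\<^sup>*" and vy: "v = y"
      have "\<delta> x y \<le> \<delta> x u + \<delta> u v" using triangle xM uv vy YM by blast
      then show ?thesis using uv(3) colouring_bound[OF c2 uv(1,4)] D1 r by simp
    next
      fix u v z assume uv: "u \<in> Y" "v \<in> Y" "\<delta> x u \<le> D1 + r" "(u, v) \<in> ?RY\<^sup>*"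
        and z: "y \<in> Z" "z \<in> Z" "\<delta> v z \<le> r" "(z, y) \<in> ?RZ\<^sup>*"
      have "\<delta> x y \<le> \<delta> x u + \<delta> u y" "\<delta> u y \<le> \<delta> u v + \<delta> v y" "\<delta> v y \<le> \<delta> v z + \<delta> z y"
        using triangle xM uv z YM ZM by blast+
      then show ?thesis
        using uv(3) colouring_bound[OF c2 uv(1,4)] z(3) colouring_bound[OF c1 z(2,4)] by simp
    qed
  qed
  then show ?thesis by (auto simp: colourable_def)
qed

end

section \<open>Word metrics\<close>

context group
begin

abbreviation letters :: "'a set \<Rightarrow> 'a set" where
  "letters T \<equiv> T \<union> (\<lambda>s. inv s) ` T"

abbreviation word_value :: "'a list \<Rightarrow> 'a" where
  "word_value ws \<equiv> foldr (\<lambda>a b. a \<otimes> b) ws \<one>"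

lemma letters_closed: "T \<subseteq> carrier G \<Longrightarrow> letters T \<subseteq> carrier G"
  by auto

lemma word_value_closed: "set ws \<subseteq> carrier G \<Longrightarrow> word_value ws \<in> carrier G"
  by (induction ws) auto

lemma word_value_append:
  "set us \<subseteq> carrier G \<Longrightarrow> set vs \<subseteq> carrier G \<Longrightarrow> word_value (us @ vs) = word_value us \<otimes> word_value vs"
  by (induction us) (auto simp: m_assoc word_value_closed)

lemma word_value_inverse:
  assumes "T \<subseteq> carrier G" "set ws \<subseteq> letters T"
  shows "set (rev (map (\<lambda>s. inv s) ws)) \<subseteq> letters T \<and>
    word_value (rev (map (\<lambda>s. inv s) ws)) = inv (word_value ws)"
  using assms(2)
proof (induction ws)
  case (Cons a ws)
  have a: "a \<in> carrier G" "inv a \<in> letters T"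
    using Cons.prems assms(1) by (auto simp: image_iff)
  have ws: "set ws \<subseteq> carrier G"
    using Cons.prems letters_closed[OF assms(1)] by auto
  then have ws': "set (rev (map (\<lambda>s. inv s) ws)) \<subseteq> carrier G"
    by auto
  then show ?case using Cons a word_value_append[OF ws', of "[inv a]"] ws
    by (auto simp: inv_mult_group word_value_closed)
qed simp

lemma word_length_le:
  assumes "set ws \<subseteq> letters T" "word_value ws = g" "length ws \<le> k"
  shows "word_length G T g \<le> k"
proof -
  have "word_length G T g \<le> length ws"
    unfolding word_length_def by (rule Least_le) (use assms in blast)
  then show ?thesis using assms(3) by simp
qed

context
  fixes T assumes T: "finite_generating_set G T"
begin

lemma T_closed: "T \<subseteq> carrier G"
  using T by (simp add: finite_generating_set_def)

lemma ex_word: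
  assumes "g \<in> carrier G"
  shows "\<exists>ws. set ws \<subseteq> letters T \<and> word_value ws = g"
proof -
  have "g \<in> generate G T" using assms T by (simp add: finite_generating_set_def)
  then show ?thesis
  proof induction
    case one
    show ?case by (rule exI[of _ "[]"]) simp
  next
    case (incl h)
    then show ?case using T_closed by (intro exI[of _ "[h]"]) auto
  next
    case (inv h)
    then show ?case using T_closed by (intro exI[of _ "[inv h]"]) auto
  next
    case (eng h1 h2)
    then obtain us vs where "set us \<subseteq> letters T" "word_value us = h1" "set vs \<subseteq> letters T" "word_value vs = h2"
      by blast
    then show ?case using word_value_append[of us vs] letters_closed[OF T_closed]
      by (intro exI[of _ "us @ vs"]) auto
  qed
qed

lemma shortest_word:
  assumes "g \<in> carrier G"
  obtains ws where "set ws \<subseteq> letters T" "word_value ws = g" "length ws = word_length G T g"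
proof -
  have "\<exists>k ws. length ws = k \<and> set ws \<subseteq> letters T \<and> word_value ws = g"
    using ex_word[OF assms] by blast
  then have "\<exists>ws. length ws = word_length G T g \<and> set ws \<subseteq> letters T \<and> word_value ws = g"
    unfolding word_length_def by (rule LeastI_ex)
  then show thesis using that by blast
qed

lemma word_length_one: "word_length G T \<one> = 0"
  using word_length_le[of "[]" T \<one> 0] by simp

lemma word_metric_le_0:
  assumes "x \<in> carrier G" "y \<in> carrier G" "word_metric G T x y \<le> 0"
  shows "x = y"
proof -
  obtain ws where "word_value ws = inv x \<otimes> y" "length ws = word_length G T (inv x \<otimes> y)"
    using shortest_word[of "inv x \<otimes> y"] assms(1,2) by auto
  then have "inv x \<otimes> y = \<one>" using assms(3) by (simp add: word_metric_def)
  then show ?thesis using assms(1,2) inv_equality[of "inv x" y] by (metis inv_closed inv_inv inv_solve_left' r_one)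
qed

lemma word_length_mult:
  assumes "g \<in> carrier G" "h \<in> carrier G"
  shows "word_length G T (g \<otimes> h) \<le> word_length G T g + word_length G T h"
proof -
  obtain us where us: "set us \<subseteq> letters T" "word_value us = g" "length us = word_length G T g"
    using shortest_word[OF assms(1)] .
  obtain vs where vs: "set vs \<subseteq> letters T" "word_value vs = h" "length vs = word_length G T h"
    using shortest_word[OF assms(2)] .
  show ?thesis
    by (rule word_length_le[of "us @ vs"])
      (use us vs letters_closed[OF T_closed] word_value_append[of us vs] in auto)
qed

lemma word_length_inv_le:
  assumes "g \<in> carrier G"
  shows "word_length G T (inv g) \<le> word_length G T g"
proof -
  obtain us where us: "set us \<subseteq> letters T" "word_value us = g" "length us = word_length G T g"
    using shortest_word[OF assms(1)] .
  then show ?thesis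
    using word_value_inverse[OF T_closed us(1)]
    by (intro word_length_le[of "rev (map (\<lambda>s. inv s) us)"]) auto
qed

lemma word_length_inv: "g \<in> carrier G \<Longrightarrow> word_length G T (inv g) = word_length G T g"
  using word_length_inv_le[of g] word_length_inv_le[of "inv g"] by simp

lemma word_metric_pseudometric: "pseudometric (carrier G) (word_metric G T)"
proof
  fix x y z assume x: "x \<in> carrier G" and y: "y \<in> carrier G"
  show "word_metric G T x x = 0" using x word_length_one by (simp add: word_metric_def)
  show "word_metric G T x y = word_metric G T y x"
    using word_length_inv[of "inv x \<otimes> y"] x y by (simp add: word_metric_def inv_mult_group)
  assume z: "z \<in> carrier G"
  have "inv x \<otimes> z = (inv x \<otimes> y) \<otimes> (inv y \<otimes> z)"
    using x y z by (metis inv_closed inv_solve_left' m_assoc m_closed)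
  then show "word_metric G T x z \<le> word_metric G T x y + word_metric G T y z"
    using word_length_mult[of "inv x \<otimes> y" "inv y \<otimes> z"] x y z by (simp add: word_metric_def)
qed

lemma word_metric_translate:
  assumes "g \<in> carrier G" "x \<in> carrier G" "y \<in> carrier G"
  shows "word_metric G T (g \<otimes> x) (g \<otimes> y) = word_metric G T x y"
proof -
  have "inv (g \<otimes> x) \<otimes> (g \<otimes> y) = inv x \<otimes> y"
    using assms by (simp add: inv_mult_group m_assoc inv_solve_left')
  then show ?thesis by (simp add: word_metric_def)
qed

lemma finite_word_ball: "finite {g \<in> carrier G. real (word_length G T g) \<le> r}"
proof (rule finite_subset)
  show "{g \<in> carrier G. real (word_length G T g) \<le> r} \<subseteq>
      word_value ` {ws. set ws \<subseteq> letters T \<and> length ws \<le> nat \<lfloor>r\<rfloor>}"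
  proof
    fix g assume g: "g \<in> {g \<in> carrier G. real (word_length G T g) \<le> r}"
    then obtain ws where "set ws \<subseteq> letters T" "word_value ws = g" "length ws = word_length G T g"
      using shortest_word[of g] by blast
    moreover have "word_length G T g \<le> nat \<lfloor>r\<rfloor>" using g by (simp add: le_nat_floor)
    ultimately show "g \<in> word_value ` {ws. set ws \<subseteq> letters T \<and> length ws \<le> nat \<lfloor>r\<rfloor>}"
      by force
  qed
  show "finite (word_value ` {ws. set ws \<subseteq> letters T \<and> length ws \<le> nat \<lfloor>r\<rfloor>})"
    using T by (intro finite_imageI finite_lists_length_le) (simp add: finite_generating_set_def)
qed

text \<open>The only form in which paths in the Cayley graph are needed: a shortest word loses its last
  letter.\<close>

lemma word_metric_last_step:
  assumes x: "x \<in> carrier G" and y: "y \<in> carrier G" and le: "word_metric G T x y \<le> real (Suc k)"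
  obtains z where "z \<in> carrier G" "word_metric G T x z \<le> real k" "inv z \<otimes> y \<in> insert \<one> (letters T)"
proof -
  obtain ws where ws: "set ws \<subseteq> letters T" "word_value ws = inv x \<otimes> y"
      "length ws = word_length G T (inv x \<otimes> y)"
    using shortest_word[of "inv x \<otimes> y"] x y by auto
  then have len: "length ws \<le> Suc k" using le by (simp add: word_metric_def)
  show thesis
  proof (cases ws rule: rev_cases)
    case Nil
    then have "word_length G T (inv x \<otimes> y) = 0" "\<one> = inv x \<otimes> y" using ws by auto
    then have "word_metric G T x y \<le> real k" by (simp add: word_metric_def)
    then show thesis using y by (intro that[of y]) auto
  next
    case (snoc us s)
    have sub: "set us \<subseteq> letters T" "s \<in> letters T" using ws snoc by auto
    then have c: "set us \<subseteq> carrier G" "s \<in> carrier G" using letters_closed[OF T_closed] by auto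
    let ?u = "word_value us"
    have u: "?u \<in> carrier G" using word_value_closed c by blast
    have "?u \<otimes> s = inv x \<otimes> y"
      using ws(2) snoc word_value_append[of us "[s]"] c by simp
    then have "y = x \<otimes> (?u \<otimes> s)" using x y u c by (simp add: inv_solve_left)
    then have "inv (x \<otimes> ?u) \<otimes> y = s"
      using x u c by (simp add: inv_solve_left' m_assoc)
    moreover have "word_metric G T x (x \<otimes> ?u) \<le> real k"
    proof -
      have "inv x \<otimes> (x \<otimes> ?u) = ?u" using x u by (simp add: m_assoc[symmetric])
      then show ?thesis
        using word_length_le[OF sub(1), of ?u k] snoc len by (simp add: word_metric_def)
    qed
    ultimately show thesis using sub(2) x u by (intro that[of "x \<otimes> ?u"]) auto
  qed
qed

end

end

lemma bounded_on_finite_sublevel: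
  fixes p q :: "'a \<Rightarrow> real"
  assumes "finite {g \<in> K. p g \<le> r}"
  shows "\<exists>r'. \<forall>g\<in>K. p g \<le> r \<longrightarrow> q g \<le> r'"
proof -
  have "\<forall>g\<in>K. p g \<le> r \<longrightarrow> q g \<le> Max (q ` {g \<in> K. p g \<le> r})"
    using assms by (auto intro!: Max_ge)
  then show ?thesis by blast
qed

text \<open>An injective homomorphism between finitely generated groups is a coarse embedding: by left
  invariance it suffices to bound each of the two lengths of \<open>g\<close> on the sets where the other one is
  bounded, and these sets are finite, because balls are finite and \<open>f\<close> is injective.  With the identity
  for \<open>f\<close> this is the independence of the generating set.\<close>

lemma colourable_subgroup:
  assumes G: "group G" and H: "group H" and S: "finite_generating_set G S" and T: "finite_generating_set H T"
    and f: "f \<in> hom G H" and inj: "inj_on f (carrier G)"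
    and col: "\<And>r. colourable (word_metric G S) (carrier G) n r"
  shows "colourable (word_metric H T) (f ` carrier G) n r"
proof -
  interpret G: group G by fact
  interpret H: group H by fact
  interpret f: group_hom G H f using f by unfold_locales
  define h where "h = inv_into (carrier G) f"
  have h: "h (f g) = g" if "g \<in> carrier G" for g using that inj by (simp add: h_def)
  let ?p = "\<lambda>g. real (word_length G S g)" and ?q = "\<lambda>g. real (word_length H T (f g))"
  have dG: "word_metric G S a b = ?p (inv\<^bsub>G\<^esub> a \<otimes>\<^bsub>G\<^esub> b)" for a b by (simp add: word_metric_def)
  have dH: "word_metric H T (f a) (f b) = ?q (inv\<^bsub>G\<^esub> a \<otimes>\<^bsub>G\<^esub> b)"
    if "a \<in> carrier G" "b \<in> carrier G" for a b
    using that by (simp add: word_metric_def)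
  have finp: "finite {g \<in> carrier G. ?p g \<le> r}" for r by (rule G.finite_word_ball[OF S])
  have finq: "finite {g \<in> carrier G. ?q g \<le> r}" for r
  proof (rule inj_on_finite)
    show "inj_on f {g \<in> carrier G. ?q g \<le> r}" using inj by (rule inj_on_subset) auto
    show "f ` {g \<in> carrier G. ?q g \<le> r} \<subseteq> {x \<in> carrier H. real (word_length H T x) \<le> r}" by auto
  qed (rule H.finite_word_ball[OF T])
  obtain r' where r': "\<And>g. g \<in> carrier G \<Longrightarrow> ?q g \<le> r \<Longrightarrow> ?p g \<le> r'"
    using bounded_on_finite_sublevel[OF finq[of r], of ?p] by blast
  show ?thesis
  proof (rule colourable_piecewise[where f = h and lab = "\<lambda>_. ()" and r' = r'])
    show "colourable (word_metric G S) (carrier G) n r'" by (rule col)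
    fix D
    obtain D' where D': "\<And>g. g \<in> carrier G \<Longrightarrow> ?p g \<le> D \<Longrightarrow> ?q g \<le> D'"
      using bounded_on_finite_sublevel[OF finp[of D], of ?q] by blast
    show "\<exists>D'. \<forall>x\<in>f ` carrier G. \<forall>y\<in>f ` carrier G. () = () \<longrightarrow>
        word_metric G S (h x) (h y) \<le> D \<longrightarrow> word_metric H T x y \<le> D'"
      using D' by (intro exI[of _ D']) (auto simp: h dH dG simp del: f.hom_mult)
  qed (use r' in \<open>auto simp: h dH dG simp del: f.hom_mult\<close>)
qed

section \<open>Groups acting on trees\<close>

text \<open>A vertex of a rooted tree is encoded as the list of choices that lead to it from the root; its
  parent is the list without the last entry, and its ancestors are the prefixes of the list.\<close>

definition adjacent :: "'v list \<Rightarrow> 'v list \<Rightarrow> bool" where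
  "adjacent u v \<longleftrightarrow> (\<exists>a. v = u @ [a]) \<or> (\<exists>a. u = v @ [a])"

lemma adjacent_sym: "adjacent u v \<Longrightarrow> adjacent v u"
  by (auto simp: adjacent_def)

lemma adjacent_length: "adjacent u v \<Longrightarrow> length v \<le> Suc (length u)"
  by (auto simp: adjacent_def)

lemma adjacent_take: "adjacent u v \<Longrightarrow> m \<le> length u \<Longrightarrow> m \<le> length v \<Longrightarrow> take m u = take m v"
  by (auto simp: adjacent_def)

text \<open>The group acts on a tree with \<open>K\<close> as the stabiliser of the root; \<open>\<nu> x\<close> is the image of the root
  under \<open>x\<close>.  The group is generated by \<open>y\<close>, which moves the root to a neighbour, and by elements of
  \<open>K\<close>.  The action itself does not occur: its content is that the fibres of \<open>\<nu>\<close> lie in left cosets of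
  \<open>K\<close>, and that a step in the Cayley graph moves the vertex along at most one edge.\<close>

locale group_on_tree = group H for H (structure) +
  fixes K :: "'a set" and y :: 'a and T :: "'a set" and \<nu> :: "'a \<Rightarrow> 'v list"
  assumes K: "subgroup K H" and y: "y \<in> carrier H"
    and T: "finite_generating_set H T" and T_sub: "T \<subseteq> insert y K"
    and root: "\<nu> \<one> = []"
    and K_step: "x \<in> carrier H \<Longrightarrow> k \<in> K \<Longrightarrow> \<nu> (x \<otimes> k) = \<nu> x"
    and y_step: "x \<in> carrier H \<Longrightarrow> adjacent (\<nu> x) (\<nu> (x \<otimes> y))"
    and fibre: "x \<in> carrier H \<Longrightarrow> z \<in> carrier H \<Longrightarrow> \<nu> x = \<nu> z \<Longrightarrow> inv x \<otimes> z \<in> K"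
    and parent: "x \<in> carrier H \<Longrightarrow> \<nu> x = u @ [a] \<Longrightarrow> \<exists>k\<in>K. \<exists>s\<in>{y, inv y}. \<nu> (x \<otimes> k \<otimes> s) = u"
begin

abbreviation \<delta> :: "'a \<Rightarrow> 'a \<Rightarrow> real" where
  "\<delta> \<equiv> word_metric H T"

abbreviation level :: "'a \<Rightarrow> nat" where
  "level x \<equiv> length (\<nu> x)"

sublocale pseudometric "carrier H" \<delta>
  by (rule word_metric_pseudometric[OF T])

lemma K_closed: "k \<in> K \<Longrightarrow> k \<in> carrier H"
  using subgroup.subset[OF K] by blast

lemma y_inv_step: "x \<in> carrier H \<Longrightarrow> adjacent (\<nu> x) (\<nu> (x \<otimes> inv y))"
  using y_step[of "x \<otimes> inv y"] y by (simp add: m_assoc adjacent_sym)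

lemma letter_step:
  assumes "z \<in> carrier H" "w \<in> carrier H" "inv z \<otimes> w \<in> insert \<one> (letters T)"
  shows "\<nu> z = \<nu> w \<or> adjacent (\<nu> z) (\<nu> w)"
proof -
  have w: "w = z \<otimes> (inv z \<otimes> w)" using assms by (simp add: m_assoc[symmetric])
  have "inv z \<otimes> w \<in> K \<or> inv z \<otimes> w = y \<or> inv z \<otimes> w = inv y"
    using assms(3) T_sub subgroup.one_closed[OF K] subgroup.m_inv_closed[OF K] by auto
  then show ?thesis
    using K_step[OF assms(1)] y_step[OF assms(1)] y_inv_step[OF assms(1)] w by metis
qed

lemma level_step:
  assumes "x \<in> carrier H" "w \<in> carrier H" "\<delta> x w \<le> real k"
  shows "level w \<le> level x + k"
  using assms(2,3)
proof (induction k arbitrary: w)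
  case 0
  then have "w = x" using word_metric_le_0[OF T assms(1)] by auto
  then show ?case by simp
next
  case (Suc k)
  obtain z where z: "z \<in> carrier H" "\<delta> x z \<le> real k" "inv z \<otimes> w \<in> insert \<one> (letters T)"
    using word_metric_last_step[OF T assms(1) Suc.prems] .
  then have "level w \<le> Suc (level z)"
    using letter_step[OF z(1) Suc.prems(1) z(3)] adjacent_length by force
  then show ?case using Suc.IH[OF z(1,2)] by simp
qed

text \<open>In a tree, two vertices with different ancestors at depth \<open>m\<close> are connected only through vertices
  of depth less than \<open>m\<close>.  A path in the Cayley graph projects to a path in the tree, so it contains an
  element over such a vertex.\<close>

lemma crossing:
  assumes x: "x \<in> carrier H" and mx: "m \<le> level x"
    and "w \<in> carrier H" "\<delta> x w \<le> real k" "m \<le> level w" "take m (\<nu> x) \<noteq> take m (\<nu> w)"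
  shows "\<exists>z\<in>carrier H. level z < m \<and> \<delta> x z \<le> real k"
  using assms(3-)
proof (induction k arbitrary: w)
  case 0
  then have "w = x" using word_metric_le_0[OF T x] by auto
  then show ?case using 0 by simp
next
  case (Suc k)
  obtain z where z: "z \<in> carrier H" "\<delta> x z \<le> real k" "inv z \<otimes> w \<in> insert \<one> (letters T)"
    using word_metric_last_step[OF T x Suc.prems(1,2)] .
  show ?case
  proof (cases "level z < m")
    case True
    then show ?thesis using z by force
  next
    case False
    then have "take m (\<nu> z) = take m (\<nu> w)"
      using letter_step[OF z(1) Suc.prems(1) z(3)] adjacent_take[of "\<nu> z" "\<nu> w" m] Suc.prems(3) by force
    then obtain z' where "z' \<in> carrier H" "level z' < m" "\<delta> x z' \<le> real k"
      using Suc.IH[OF z(1,2)] False Suc.prems(4) by auto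
    then show ?thesis by force
  qed
qed

text \<open>The elements that can be written with exactly \<open>j\<close> letters \<open>y\<close> or \<open>y\<^sup>-\<^sup>1\<close> and any number of letters from
  \<open>K\<close>.  In contrast to the level, this is visibly additive under products and invariant under
  inversion, and it bounds the level from above.\<close>

inductive stable_letters :: "nat \<Rightarrow> 'a \<Rightarrow> bool" where
  sl_K: "k \<in> K \<Longrightarrow> stable_letters 0 k"
| sl_y: "stable_letters 1 y"
| sl_y_inv: "stable_letters 1 (inv y)"
| sl_mult: "stable_letters i g \<Longrightarrow> stable_letters j h \<Longrightarrow> stable_letters (i + j) (g \<otimes> h)"

lemma stable_letters_closed: "stable_letters j g \<Longrightarrow> g \<in> carrier H"
  by (induction rule: stable_letters.induct) (auto simp: y K_closed)

lemma stable_letters_inv: "stable_letters j g \<Longrightarrow> stable_letters j (inv g)"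
proof (induction rule: stable_letters.induct)
  case (sl_mult i g j h)
  then have "stable_letters (j + i) (inv h \<otimes> inv g)" by (intro stable_letters.sl_mult)
  then show ?case
    using stable_letters_closed[OF sl_mult(1)] stable_letters_closed[OF sl_mult(2)]
    by (simp add: inv_mult_group add.commute)
qed (use y subgroup.m_inv_closed[OF K] in \<open>auto intro: sl_K sl_y[simplified] sl_y_inv[simplified]\<close>)

lemma stable_letters_level:
  "stable_letters j g \<Longrightarrow> x \<in> carrier H \<Longrightarrow> level (x \<otimes> g) \<le> level x + j"
proof (induction arbitrary: x rule: stable_letters.induct)
  case (sl_mult i g j h)
  have c: "g \<in> carrier H" "h \<in> carrier H" using stable_letters_closed sl_mult by auto
  have "level (x \<otimes> g \<otimes> h) \<le> level (x \<otimes> g) + j" using sl_mult c by auto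
  also have "level (x \<otimes> g) \<le> level x + i" using sl_mult by auto
  finally show ?case using c sl_mult.prems by (simp add: m_assoc)
qed (use K_step y_step y_inv_step adjacent_length in \<open>force+\<close>)

text \<open>Climbing up from a vertex to its ancestor takes one letter \<open>y\<close> or \<open>y\<^sup>-\<^sup>1\<close> for each edge.\<close>

lemma ancestor:
  assumes "x \<in> carrier H" "\<nu> x = u @ v"
  shows "\<exists>z\<in>carrier H. \<nu> z = u \<and> stable_letters (length v) (inv z \<otimes> x)"
  using assms
proof (induction v arbitrary: x rule: rev_induct)
  case Nil
  then have "\<nu> x = u" "inv x \<otimes> x \<in> K" using subgroup.one_closed[OF K] by auto
  then show ?case using Nil(1) sl_K by (intro bexI[of _ x]) auto
next
  case (snoc a v)
  then obtain k s where ks: "k \<in> K" "s \<in> {y, inv y}" "\<nu> (x \<otimes> k \<otimes> s) = u @ v"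
    using parent[of x "u @ v" a] by auto
  have c: "k \<in> carrier H" "s \<in> carrier H" using ks y K_closed by auto
  define w where "w = x \<otimes> k \<otimes> s"
  have w: "w \<in> carrier H" "\<nu> w = u @ v" using ks c snoc.prems by (auto simp: w_def)
  obtain z where z: "z \<in> carrier H" "\<nu> z = u" "stable_letters (length v) (inv z \<otimes> w)"
    using snoc.IH[OF w] by blast
  have "stable_letters 1 (inv s)" using ks(2) y by (auto intro: sl_y[simplified] sl_y_inv[simplified])
  moreover have "stable_letters 0 (inv k)" using ks(1) subgroup.m_inv_closed[OF K] sl_K by blast
  ultimately have "stable_letters (1 + 0) (inv s \<otimes> inv k)" by (rule sl_mult)
  with z(3) have "stable_letters (length v + (1 + 0)) ((inv z \<otimes> w) \<otimes> (inv s \<otimes> inv k))" by (rule sl_mult)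
  moreover have "(inv z \<otimes> w) \<otimes> (inv s \<otimes> inv k) = inv z \<otimes> x"
  proof -
    have "w \<otimes> inv s = x \<otimes> k" using c snoc.prems(1) by (simp add: w_def m_assoc)
    then have "w \<otimes> inv s \<otimes> inv k = x" using c snoc.prems(1) by (simp add: m_assoc)
    then have "w \<otimes> (inv s \<otimes> inv k) = x" using w(1) c by (simp add: m_assoc)
    then show ?thesis using z(1) w(1) c by (simp add: m_assoc)
  qed
  ultimately show ?case using z by auto
qed

text \<open>The way up from one vertex to the common ancestor and down to the other one is a word with
  few stable letters.  It shows that the set of elements whose vertex lies below a given vertex, at
  bounded distance from it, is contained in a left translate of a bounded level set.\<close>

lemma common_ancestor:
  assumes "x \<in> carrier H" "\<nu> x = u @ v" "w \<in> carrier H" "\<nu> w = u @ v'"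
  shows "level (inv x \<otimes> w) \<le> length v + length v'"
proof -
  obtain p where p: "p \<in> carrier H" "\<nu> p = u" "stable_letters (length v) (inv p \<otimes> x)"
    using ancestor[OF assms(1,2)] by blast
  obtain q where q: "q \<in> carrier H" "\<nu> q = u" "stable_letters (length v') (inv q \<otimes> w)"
    using ancestor[OF assms(3,4)] by blast
  have "stable_letters 0 (inv p \<otimes> q)" using fibre[of p q] p q sl_K by auto
  then have "stable_letters (length v + (0 + length v')) (inv (inv p \<otimes> x) \<otimes> ((inv p \<otimes> q) \<otimes> (inv q \<otimes> w)))"
    using p(3) q(3) by (intro sl_mult stable_letters_inv)
  moreover have "inv (inv p \<otimes> x) \<otimes> ((inv p \<otimes> q) \<otimes> (inv q \<otimes> w)) = inv x \<otimes> w"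
  proof -
    have "(inv p \<otimes> q) \<otimes> (inv q \<otimes> w) = inv p \<otimes> w"
      using p(1) q(1) assms(3) by (metis inv_closed inv_solve_left' m_assoc m_closed)
    moreover have "p \<otimes> (inv p \<otimes> w) = w" using p(1) assms(3) by (simp add: m_assoc[symmetric])
    ultimately show ?thesis using p(1) assms by (simp add: inv_mult_group m_assoc)
  qed
  ultimately show ?thesis using stable_letters_level[of _ "inv x \<otimes> w" \<one>] assms root by fastforce
qed

definition levels :: "nat \<Rightarrow> 'a set" where
  "levels R = {x \<in> carrier H. level x \<le> R}"

lemma levels_0: "levels 0 = K"
proof
  show "levels 0 \<subseteq> K"
  proof
    fix x assume "x \<in> levels 0"
    then have "x \<in> carrier H" "\<nu> \<one> = \<nu> x" by (auto simp: levels_def root)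
    then show "x \<in> K" using fibre[of \<one> x] by simp
  qed
  show "K \<subseteq> levels 0" using K_step[of \<one>] K_closed root by (auto simp: levels_def)
qed

text \<open>Induction on \<open>R\<close>.  At a given scale the next level set is split into the points \<open>Y\<close> close to the previous
  level set, which inherit its dimension from it, and the remaining points \<open>Z\<close>.  The latter lie in
  left cosets of \<open>K\<close>, all isometric to subsets of \<open>K\<close>, and no step of a chain leads from one coset to another: by
  \<open>crossing\<close> its end points would be close to the previous level set.\<close>

lemma colourable_levels:
  assumes K_col: "\<And>r. colourable \<delta> K n r"
  shows "colourable \<delta> (levels R) n r"
proof (induction R arbitrary: r)
  case 0
  show ?case using K_col levels_0 by simp
next
  case (Suc R)
  define k where "k = nat \<lceil>r\<rceil>"
  have rk: "r \<le> real k" by (simp add: k_def real_nat_ceiling_ge)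
  define Y where "Y = {x \<in> levels (Suc R). \<exists>z\<in>levels R. \<delta> x z \<le> k}"
  define Z where "Z = levels (Suc R) - Y"
  define p where "p x = (SOME z. z \<in> levels R \<and> \<delta> x z \<le> k)" for x
  have p: "p x \<in> levels R \<and> \<delta> x (p x) \<le> k" if "x \<in> Y" for x
    unfolding p_def by (rule someI_ex) (use that in \<open>auto simp: Y_def\<close>)
  have inH: "levels R' \<subseteq> carrier H" for R' by (auto simp: levels_def)
  have quad: "\<delta> (p x) (p w) \<le> \<delta> x w + 2 * k \<and> \<delta> x w \<le> \<delta> (p x) (p w) + 2 * k" if "x \<in> Y" "w \<in> Y" for x w
  proof -
    have c: "x \<in> carrier H" "w \<in> carrier H" "p x \<in> carrier H" "p w \<in> carrier H"
      using that p inH by (auto simp: Y_def)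
    have "\<delta> (p x) (p w) \<le> \<delta> (p x) x + \<delta> x (p w)" "\<delta> x (p w) \<le> \<delta> x w + \<delta> w (p w)"
      "\<delta> x w \<le> \<delta> x (p x) + \<delta> (p x) w" "\<delta> (p x) w \<le> \<delta> (p x) (p w) + \<delta> (p w) w"
      using triangle c by blast+
    moreover have "\<delta> (p x) x = \<delta> x (p x)" "\<delta> (p w) w = \<delta> w (p w)" using commute c by blast+
    ultimately show ?thesis using p[OF that(1)] p[OF that(2)] by simp
  qed
  have Y: "colourable \<delta> Y n s" for s
  proof (rule colourable_piecewise[where f = p and lab = "\<lambda>_. ()" and r' = "s + 2 * k"])
    show "colourable \<delta> (levels R) n (s + 2 * k)" by (rule Suc.IH)
    show "\<exists>D'. \<forall>x\<in>Y. \<forall>w\<in>Y. () = () \<longrightarrow> \<delta> (p x) (p w) \<le> D \<longrightarrow> \<delta> x w \<le> D'" for D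
      using quad by (intro exI[of _ "D + 2 * k"]) fastforce
  qed (use p quad in fastforce)+
  \<comment> \<open>A base point in each coset, which is moved to the identity.\<close>
  define b where "b v = (SOME x. x \<in> carrier H \<and> \<nu> x = v)" for v
  have b: "b (\<nu> x) \<in> carrier H \<and> \<nu> (b (\<nu> x)) = \<nu> x" if "x \<in> carrier H" for x
    unfolding b_def by (rule someI_ex) (use that in blast)
  have ZH: "Z \<subseteq> carrier H" using inH by (auto simp: Z_def)
  have iso: "\<delta> (inv (b (\<nu> x)) \<otimes> x) (inv (b (\<nu> w)) \<otimes> w) = \<delta> x w" if "x \<in> Z" "w \<in> Z" "\<nu> x = \<nu> w" for x w
    using word_metric_translate[OF T, of "inv (b (\<nu> w))" x w] that ZH b by auto
  have Zlev: "level x = Suc R" if "x \<in> Z" for x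
  proof (rule ccontr)
    assume "level x \<noteq> Suc R"
    then have "x \<in> levels R" "\<delta> x x \<le> k" using that self[of x] by (auto simp: Z_def levels_def)
    then show False using that by (auto simp: Z_def Y_def)
  qed
  have "colourable \<delta> Z n k"
  proof (rule colourable_piecewise[where f = "\<lambda>x. inv (b (\<nu> x)) \<otimes> x" and lab = \<nu> and r' = k])
    show "colourable \<delta> K n k" by (rule K_col)
    fix x assume x: "x \<in> Z"
    then show "inv (b (\<nu> x)) \<otimes> x \<in> K" using b[of x] fibre[of "b (\<nu> x)" x] ZH by auto
    fix w assume w: "w \<in> Z" and d: "\<delta> x w \<le> k"
    show "\<nu> x = \<nu> w"
    proof (rule ccontr)
      assume "\<nu> x \<noteq> \<nu> w"
      then obtain z where "z \<in> carrier H" "level z < Suc R" "\<delta> x z \<le> k"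
        using crossing[of x "Suc R" w k] x w d ZH Zlev[OF x] Zlev[OF w] by auto
      then show False using x by (auto simp: Z_def Y_def levels_def)
    qed
  qed (use iso in auto)
  then have "colourable \<delta> (Y \<union> Z) n k"
    using Y ZH inH by (intro colourable_union) (auto simp: Z_def Y_def)
  moreover have "Y \<union> Z = levels (Suc R)" by (auto simp: Z_def Y_def)
  ultimately show ?case using rk colourable_scale_mono by metis
qed

text \<open>The levels are cut into bands of width \<open>L > k\<close>, so that a step of length \<open>k\<close> cannot jump over a band.
  Bands of equal parity are given the same \<open>n + 1\<close> colours.  A chain inside the bands of one parity stays
  in one band, and keeps its ancestor \<open>k\<close> levels closer to the root than that band, because the path of
  a single step does not get closer than this.  The elements over one band with a given such ancestor
  lie in a translate of a level set.\<close>

lemma colourable_tree: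
  assumes K_col: "\<And>r. colourable \<delta> K n r"
  shows "colourable \<delta> (carrier H) (2 * n + 1) r"
proof -
  define k where "k = nat \<lceil>r\<rceil>"
  have rk: "r \<le> real k" by (simp add: k_def real_nat_ceiling_ge)
  define L where "L = Suc k"
  define band where "band x = level x div L" for x
  \<comment> \<open>The subtraction is truncated: in the lowest band the ancestor may be the root.\<close>
  define lab where "lab x = (band x, take (band x * L - k) (\<nu> x))" for x
  define b where "b l = (SOME x. x \<in> carrier H \<and> lab x = l)" for l
  have b: "b (lab x) \<in> carrier H \<and> lab (b (lab x)) = lab x" if "x \<in> carrier H" for x
    unfolding b_def by (rule someI_ex) (use that in blast)
  define P where "P i = {x \<in> carrier H. band x mod 2 = i}" for i :: nat
  have band: "band x * L \<le> level x \<and> level x < band x * L + L" for x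
    using div_mult_mod_eq[of "level x" L] mod_less_divisor[of L "level x"]
    unfolding band_def L_def by linarith
  have col: "colourable \<delta> (P i) n k" for i
  proof (rule colourable_piecewise[where f = "\<lambda>x. inv (b (lab x)) \<otimes> x" and lab = lab and r' = k])
    show "colourable \<delta> (levels (2 * (L + k))) n k" by (rule colourable_levels[OF K_col])
    fix x assume x: "x \<in> P i"
    then have xH: "x \<in> carrier H" by (simp add: P_def)
    let ?m = "band x * L - k" and ?b = "b (lab x)"
    have bx: "?b \<in> carrier H" "band ?b = band x" "take ?m (\<nu> ?b) = take ?m (\<nu> x)"
      using b[OF xH] by (auto simp: lab_def)
    have "level (inv ?b \<otimes> x) \<le> length (drop ?m (\<nu> ?b)) + length (drop ?m (\<nu> x))"
      using bx xH by (intro common_ancestor[where u = "take ?m (\<nu> x)"]) (metis append_take_drop_id)+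
    also have "\<dots> \<le> 2 * (L + k)" using band[of x] band[of ?b] bx(2) by auto
    finally show "inv ?b \<otimes> x \<in> levels (2 * (L + k))" using bx(1) xH by (simp add: levels_def)
    fix w assume w: "w \<in> P i" and d: "\<delta> x w \<le> k"
    then have wH: "w \<in> carrier H" by (simp add: P_def)
    have lev: "level w \<le> level x + k" "level x \<le> level w + k"
      using level_step[OF xH wH d] level_step[OF wH xH] commute[OF xH wH] d by auto
    have far: "level p' + k < level q" if "band p' < band q" "band p' mod 2 = band q mod 2" for p' q
    proof -
      have "band p' + 2 \<le> band q" using that by presburger
      then have "(band p' + 2) * L \<le> band q * L" by (rule mult_le_mono1)
      then show ?thesis using band[of p'] band[of q] by (simp add: L_def)
    qed
    have mod2: "band x mod 2 = band w mod 2" using x w by (simp add: P_def)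
    have "\<not> band x < band w" using far[OF _ mod2] lev(1) by linarith
    moreover have "\<not> band w < band x" using far[OF _ mod2[symmetric]] lev(2) by linarith
    ultimately have same: "band x = band w" by simp
    moreover have "take ?m (\<nu> x) = take ?m (\<nu> w)"
    proof (rule ccontr)
      assume "take ?m (\<nu> x) \<noteq> take ?m (\<nu> w)"
      moreover have "?m \<le> level x" "?m \<le> level w" using band[of x] band[of w] same by auto
      ultimately obtain z where z: "z \<in> carrier H" "level z < ?m" "\<delta> x z \<le> k"
        using crossing[OF xH _ wH d] by blast
      then have "level x \<le> level z + k" using level_step[OF z(1) xH] commute[OF xH z(1)] by simp
      then show False using z(2) band[of x] by linarith
    qed
    ultimately show "lab x = lab w" by (simp add: lab_def)
  next
    have iso: "\<delta> (inv (b (lab x)) \<otimes> x) (inv (b (lab w)) \<otimes> w) = \<delta> x w"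
      if "x \<in> P i" "w \<in> P i" "lab x = lab w" for x w
      using word_metric_translate[OF T, of "inv (b (lab w))" x w] that b[of w] by (auto simp: P_def)
    then show "\<exists>D'. \<forall>x\<in>P i. \<forall>w\<in>P i. lab x = lab w \<longrightarrow>
        \<delta> (inv (b (lab x)) \<otimes> x) (inv (b (lab w)) \<otimes> w) \<le> D \<longrightarrow> \<delta> x w \<le> D'" for D
      by (intro exI[of _ D]) auto
    show "\<delta> (inv (b (lab x)) \<otimes> x) (inv (b (lab w)) \<otimes> w) \<le> k"
      if "x \<in> P i" "w \<in> P i" "lab x = lab w" "\<delta> x w \<le> k" for x w
      using iso that by simp
  qed
  have "colourable \<delta> (P 0 \<union> P 1) (n + n + 1) k"
    by (intro colourable_add col) (auto simp: P_def)
  moreover have "P 0 \<union> P 1 = carrier H" by (auto simp: P_def)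
  ultimately show ?thesis using rk colourable_scale_mono[of \<delta> "carrier H" "2 * n + 1" k r]
    by (simp add: mult_2)
qed

end

section \<open>Presented groups\<close>

lemma gwords_append [simp]: "u @ v \<in> gwords X \<longleftrightarrow> u \<in> gwords X \<and> v \<in> gwords X"
  by (simp add: gwords_def)

lemma gwords_Nil [simp]: "[] \<in> gwords X"
  by (simp add: gwords_def)

lemma gwords_Cons [simp]: "a # w \<in> gwords X \<longleftrightarrow> fst a \<in> X \<and> w \<in> gwords X"
  by (auto simp: gwords_def mem_Times_iff)

definition inverse_word :: "'x gword \<Rightarrow> 'x gword" where
  "inverse_word w = rev (map (\<lambda>(x, b). (x, \<not> b)) w)"

lemma inverse_word_simps [simp]:
  "inverse_word [] = []" "inverse_word ((x, b) # w) = inverse_word w @ [(x, \<not> b)]"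
  by (simp_all add: inverse_word_def)

lemma inverse_word_inverse_word [simp]: "inverse_word (inverse_word w) = w"
  by (simp add: inverse_word_def rev_map case_prod_beta comp_def)

lemma inverse_word_gwords [simp]: "inverse_word w \<in> gwords X \<longleftrightarrow> w \<in> gwords X"
  by (induction w) auto

context
  fixes X :: "'x set" and R :: "('x gword \<times> 'x gword) set"
begin

lemma pres_eq_gwords: "pres_eq X R u v \<Longrightarrow> u \<in> gwords X \<and> v \<in> gwords X"
  by (induction rule: pres_eq.induct) auto

text \<open>The equivalence generated by the relations is a congruence; this is why concatenation of
  representatives gives a well-defined product.\<close>

lemma pres_eq_context:
  "pres_eq X R u v \<Longrightarrow> p \<in> gwords X \<Longrightarrow> q \<in> gwords X \<Longrightarrow> pres_eq X R (p @ u @ q) (p @ v @ q)"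
proof (induction rule: pres_eq.induct)
  case (refl u)
  then show ?case by (intro pres_eq.refl) auto
next
  case (cancel p' q' x b)
  then show ?case using pres_eq.cancel[of "p @ p'" X "q' @ q" x R b] by simp
next
  case (relation p' q' u v)
  then show ?case using pres_eq.relation[of "p @ p'" X "q' @ q" u v R] by simp
qed (auto intro: pres_eq.sym pres_eq.trans)

lemma pres_eq_append: "pres_eq X R u u' \<Longrightarrow> pres_eq X R v v' \<Longrightarrow> pres_eq X R (u @ v) (u' @ v')"
  using pres_eq_context[of u u' "[]" v] pres_eq_context[of v v' u' "[]"]
  by (auto dest: pres_eq_gwords intro: pres_eq.trans)

lemma pres_eq_inverse_word: "w \<in> gwords X \<Longrightarrow> pres_eq X R (w @ inverse_word w) []"
proof (induction w)
  case Nil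
  then show ?case by (auto intro: pres_eq.refl)
next
  case (Cons a w)
  obtain x b where a: "a = (x, b)" by (cases a)
  have "pres_eq X R ([a] @ (w @ inverse_word w) @ [(x, \<not> b)]) ([a] @ [] @ [(x, \<not> b)])"
    using Cons a by (intro pres_eq_context) auto
  moreover have "pres_eq X R ([a] @ [] @ [(x, \<not> b)]) []"
    using pres_eq.cancel[of "[]" X "[]" x R b] Cons.prems a by simp
  ultimately show ?case using a by (auto intro: pres_eq.trans)
qed

abbreviation word_class :: "'x gword \<Rightarrow> 'x gword set" where
  "word_class w \<equiv> pres_rel X R `` {w}"

lemma equiv_pres_rel: "equiv (gwords X) (pres_rel X R)"
proof (rule equivI)
  show "pres_rel X R \<subseteq> gwords X \<times> gwords X"
    using pres_eq_gwords by (auto simp: pres_rel_def)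
  show "refl_on (gwords X) (pres_rel X R)"
    by (auto simp: refl_on_def pres_rel_def intro: pres_eq.refl)
  show "sym (pres_rel X R)" by (auto simp: sym_def pres_rel_def intro: pres_eq.sym)
  show "trans (pres_rel X R)" by (auto simp: trans_def pres_rel_def intro: pres_eq.trans)
qed

lemma word_class_eq_iff:
  "u \<in> gwords X \<Longrightarrow> v \<in> gwords X \<Longrightarrow> word_class u = word_class v \<longleftrightarrow> pres_eq X R u v"
  using eq_equiv_class_iff[OF equiv_pres_rel] by (simp add: pres_rel_def)

lemma word_class_eq: "pres_eq X R u v \<Longrightarrow> word_class u = word_class v"
  using word_class_eq_iff pres_eq_gwords by blast

lemma carrier_presented_group: "carrier (presented_group X R) = word_class ` gwords X"
  by (auto simp: presented_group_def quotient_def)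

lemma one_presented_group: "\<one>\<^bsub>presented_group X R\<^esub> = word_class []"
  by (simp add: presented_group_def)

text \<open>The product of two classes is the saturation of the set of all concatenations, which are all
  equivalent.\<close>

lemma mult_presented_group:
  assumes "u \<in> gwords X" "v \<in> gwords X"
  shows "word_class u \<otimes>\<^bsub>presented_group X R\<^esub> word_class v = word_class (u @ v)"
proof -
  have "pres_rel X R `` {u' @ v' | u' v'. u' \<in> word_class u \<and> v' \<in> word_class v} = word_class (u @ v)"
  proof
    show "pres_rel X R `` {u' @ v' | u' v'. u' \<in> word_class u \<and> v' \<in> word_class v} \<subseteq> word_class (u @ v)"
      by (auto simp: pres_rel_def intro: pres_eq.trans pres_eq_append)
    show "word_class (u @ v) \<subseteq> pres_rel X R `` {u' @ v' | u' v'. u' \<in> word_class u \<and> v' \<in> word_class v}"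
      using assms pres_eq.refl[of u X R] pres_eq.refl[of v X R] by (auto simp: pres_rel_def)
  qed
  then show ?thesis by (simp add: presented_group_def)
qed

lemma group_presented_group: "group (presented_group X R)"
proof (rule groupI)
  let ?P = "presented_group X R"
  fix U assume "U \<in> carrier ?P"
  then obtain u where u: "u \<in> gwords X" "U = word_class u" by (auto simp: carrier_presented_group)
  show "\<one>\<^bsub>?P\<^esub> \<otimes>\<^bsub>?P\<^esub> U = U" using u by (simp add: one_presented_group mult_presented_group)
  have "word_class (inverse_word u) \<otimes>\<^bsub>?P\<^esub> U = \<one>\<^bsub>?P\<^esub>"
    using u pres_eq_inverse_word[of "inverse_word u"]
    by (simp add: one_presented_group mult_presented_group word_class_eq)
  then show "\<exists>V\<in>carrier ?P. V \<otimes>\<^bsub>?P\<^esub> U = \<one>\<^bsub>?P\<^esub>"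
    using u by (auto simp: carrier_presented_group)
qed (auto simp: carrier_presented_group one_presented_group mult_presented_group)

end

section \<open>Normal forms in HNN extensions\<close>

text \<open>A vertex of the Bass-Serre tree, that is, a coset of \<open>G\<close>, given by its normal form
  \<open>t\<^sub>1 y\<^bsup>e\<^sub>1\<^esup> \<dots> t\<^sub>k y\<^bsup>e\<^sub>k\<^esup>\<close>, where \<open>True\<close> stands for the exponent \<open>1\<close> and \<open>False\<close> for \<open>-1\<close>.  The entries are
  stored from the last to the first, since words act at the end.\<close>

type_synonym 'a vertex = "('a \<times> bool) list"

locale hnn = group G for G (structure) +
  fixes A :: "'a set" and \<phi> :: "'a \<Rightarrow> 'a"
  assumes A: "subgroup A G" and \<phi>: "\<phi> \<in> mon (G\<lparr>carrier := A\<rparr>) G"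
begin

lemma \<phi>_hom: "group_hom (G\<lparr>carrier := A\<rparr>) G \<phi>"
  using \<phi> subgroup.subgroup_is_group[OF A group_axioms] group_axioms
  by (auto simp: mon_def group_hom_def group_hom_axioms_def)

lemma \<phi>_inj: "inj_on \<phi> A"
  using \<phi> by (simp add: mon_def)

text \<open>The subgroup of those \<open>s\<close> that can be moved to the right past \<open>y\<^bsup>e\<^esup>\<close>, by \<open>s y\<^bsup>e\<^esup> = y\<^bsup>e\<^esup> \<theta> e s\<close>; the two
  signs are interchanged by \<open>\<theta>\<close>.\<close>

definition assoc_sub :: "bool \<Rightarrow> 'a set" where
  "assoc_sub e = (if e then \<phi> ` A else A)"

definition \<theta> :: "bool \<Rightarrow> 'a \<Rightarrow> 'a" where
  "\<theta> e s = (if e then inv_into A \<phi> s else \<phi> s)"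

lemma assoc_sub_subgroup: "subgroup (assoc_sub e) G"
  using A group_hom.img_is_subgroup[OF \<phi>_hom] by (simp add: assoc_sub_def)

lemma assoc_sub_closed: "s \<in> assoc_sub e \<Longrightarrow> s \<in> carrier G"
  using subgroup.subset[OF assoc_sub_subgroup] by blast

lemma \<theta>_closed: "s \<in> assoc_sub e \<Longrightarrow> \<theta> e s \<in> assoc_sub (\<not> e)"
  by (auto simp: assoc_sub_def \<theta>_def \<phi>_inj)

lemma \<theta>_\<theta>: "s \<in> assoc_sub e \<Longrightarrow> \<theta> (\<not> e) (\<theta> e s) = s"
  by (auto simp: assoc_sub_def \<theta>_def \<phi>_inj)

lemma \<theta>_mult:
  assumes "s \<in> assoc_sub e" "s' \<in> assoc_sub e"
  shows "\<theta> e (s \<otimes> s') = \<theta> e s \<otimes> \<theta> e s'"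
proof -
  have m: "\<phi> (a \<otimes> b) = \<phi> a \<otimes> \<phi> b" if "a \<in> A" "b \<in> A" for a b
    using group_hom.hom_mult[OF \<phi>_hom] that by simp
  show ?thesis
  proof (cases e)
    case True
    then obtain a b where ab: "a \<in> A" "b \<in> A" "s = \<phi> a" "s' = \<phi> b"
      using assms by (auto simp: assoc_sub_def)
    then have "s \<otimes> s' = \<phi> (a \<otimes> b)" "a \<otimes> b \<in> A" using m subgroup.m_closed[OF A] by auto
    then show ?thesis using True ab \<phi>_inj by (simp add: \<theta>_def)
  next
    case False
    then show ?thesis using assms m by (simp add: assoc_sub_def \<theta>_def)
  qed
qed

text \<open>A representative of the left coset of \<open>g\<close> modulo \<open>assoc_sub e\<close>; the subgroup itself is
  represented by \<open>\<one>\<close>, which makes cancellation of stable letters recognisable.\<close>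

definition rep :: "bool \<Rightarrow> 'a \<Rightarrow> 'a" where
  "rep e g = (if g \<in> assoc_sub e then \<one> else SOME t. t \<in> carrier G \<and> inv t \<otimes> g \<in> assoc_sub e)"

lemma rep_sub: "s \<in> assoc_sub e \<Longrightarrow> rep e s = \<one>"
  by (simp add: rep_def)

lemma rep_props:
  assumes "g \<in> carrier G"
  shows "rep e g \<in> carrier G \<and> inv (rep e g) \<otimes> g \<in> assoc_sub e"
proof (cases "g \<in> assoc_sub e")
  case True
  then show ?thesis using assms by (simp add: rep_def)
next
  case False
  have "\<exists>t. t \<in> carrier G \<and> inv t \<otimes> g \<in> assoc_sub e"
    using assms subgroup.one_closed[OF assoc_sub_subgroup] by (intro exI[of _ g]) simp
  then show ?thesis unfolding rep_def using False by (simp only: if_False) (rule someI_ex)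
qed

lemma mult_assoc_sub_iff:
  assumes "g \<in> carrier G" "s \<in> assoc_sub e"
  shows "g \<otimes> s \<in> assoc_sub e \<longleftrightarrow> g \<in> assoc_sub e"
proof
  assume "g \<otimes> s \<in> assoc_sub e"
  then have "g \<otimes> s \<otimes> inv s \<in> assoc_sub e"
    using assms subgroup.m_closed[OF assoc_sub_subgroup] subgroup.m_inv_closed[OF assoc_sub_subgroup] by blast
  then show "g \<in> assoc_sub e" using assms assoc_sub_closed by (simp add: m_assoc)
qed (use assms subgroup.m_closed[OF assoc_sub_subgroup] in blast)

lemma rep_mult:
  assumes "g \<in> carrier G" "s \<in> assoc_sub e"
  shows "rep e (g \<otimes> s) = rep e g"
proof -
  have "inv t \<otimes> (g \<otimes> s) \<in> assoc_sub e \<longleftrightarrow> inv t \<otimes> g \<in> assoc_sub e" if "t \<in> carrier G" for t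
    using mult_assoc_sub_iff[of "inv t \<otimes> g" s e] assms that assoc_sub_closed by (simp add: m_assoc)
  then have "(\<lambda>t. t \<in> carrier G \<and> inv t \<otimes> (g \<otimes> s) \<in> assoc_sub e) =
      (\<lambda>t. t \<in> carrier G \<and> inv t \<otimes> g \<in> assoc_sub e)" by blast
  then show ?thesis using mult_assoc_sub_iff[OF assms] by (simp add: rep_def)
qed

lemma rep_rep:
  assumes "g \<in> carrier G"
  shows "rep e (rep e g) = rep e g"
proof -
  let ?t = "rep e g"
  have t: "?t \<in> carrier G" "inv ?t \<otimes> g \<in> assoc_sub e" using rep_props[OF assms] by auto
  then have "rep e (?t \<otimes> (inv ?t \<otimes> g)) = rep e ?t" by (intro rep_mult)
  moreover have "?t \<otimes> (inv ?t \<otimes> g) = g" using t(1) assms by (simp add: m_assoc[symmetric])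
  ultimately show ?thesis by simp
qed

text \<open>The list head is the last syllable.  The forbidden case is \<open>y\<^bsup>-e\<^esup> \<one> y\<^bsup>e\<^esup>\<close>.\<close>

fun reduced :: "'a vertex \<Rightarrow> bool" where
  "reduced [] \<longleftrightarrow> True"
| "reduced ((t, e) # l) \<longleftrightarrow> t \<in> carrier G \<and> rep e t = t \<and> reduced l \<and>
     (case l of [] \<Rightarrow> True | (t', e') # l' \<Rightarrow> \<not> (t = \<one> \<and> e' = (\<not> e)))"

definition normal_forms :: "('a vertex \<times> 'a) set" where
  "normal_forms = {(l, g). reduced l \<and> g \<in> carrier G}"

fun base_act :: "'a \<Rightarrow> 'a vertex \<times> 'a \<Rightarrow> 'a vertex \<times> 'a" where
  "base_act h (l, g) = (l, g \<otimes> h)"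

text \<open>Appending \<open>y\<^bsup>e\<^esup>\<close> removes a syllable when the normal form ends in \<open>y\<^bsup>-e\<^esup> g\<close> with \<open>g\<close> in
  \<open>assoc_sub e\<close>, which is equivalent to \<open>rep e g = \<one>\<close>.\<close>

definition cancels :: "bool \<Rightarrow> 'a vertex \<times> 'a \<Rightarrow> bool" where
  "cancels e \<omega> \<longleftrightarrow> fst \<omega> \<noteq> [] \<and> snd (hd (fst \<omega>)) = (\<not> e) \<and> rep e (snd \<omega>) = \<one>"

text \<open>Multiplication by \<open>y\<^bsup>e\<^esup>\<close> on the right: \<open>g\<close> is split into its representative \<open>t\<close> and an element of
  \<open>assoc_sub e\<close>, which is moved past \<open>y\<^bsup>e\<^esup>\<close> and becomes \<open>s\<close>.\<close>

definition stable_act :: "bool \<Rightarrow> 'a vertex \<times> 'a \<Rightarrow> 'a vertex \<times> 'a" where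
  "stable_act e \<omega> = (let l = fst \<omega>; t = rep e (snd \<omega>); s = \<theta> e (inv t \<otimes> snd \<omega>) in
     if cancels e \<omega> then (tl l, fst (hd l) \<otimes> s) else ((t, e) # l, s))"

lemma base_act_closed: "\<omega> \<in> normal_forms \<Longrightarrow> h \<in> carrier G \<Longrightarrow> base_act h \<omega> \<in> normal_forms"
  by (cases \<omega>) (auto simp: normal_forms_def)

lemma base_act_mult:
  "\<omega> \<in> normal_forms \<Longrightarrow> g \<in> carrier G \<Longrightarrow> h \<in> carrier G \<Longrightarrow>
    base_act h (base_act g \<omega>) = base_act (g \<otimes> h) \<omega>"
  by (cases \<omega>) (auto simp: normal_forms_def m_assoc)

lemma base_act_one: "\<omega> \<in> normal_forms \<Longrightarrow> base_act \<one> \<omega> = \<omega>"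
  by (cases \<omega>) (auto simp: normal_forms_def)

lemma stable_act_closed:
  assumes "\<omega> \<in> normal_forms"
  shows "stable_act e \<omega> \<in> normal_forms"
proof -
  obtain l g where \<omega>: "\<omega> = (l, g)" by (cases \<omega>)
  then have lg: "reduced l" "g \<in> carrier G" using assms by (auto simp: normal_forms_def)
  have r: "rep e g \<in> carrier G" "rep e (rep e g) = rep e g"
    "\<theta> e (inv (rep e g) \<otimes> g) \<in> carrier G"
    using rep_props[OF lg(2)] rep_rep[OF lg(2)] \<theta>_closed assoc_sub_closed by blast+
  show ?thesis
  proof (cases l)
    case Nil
    then show ?thesis using \<omega> r by (simp add: normal_forms_def stable_act_def Let_def cancels_def)
  next
    case (Cons a l')
    obtain t' e' where "a = (t', e')" by (cases a)
    then show ?thesis using \<omega> r lg Cons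
      by (auto simp: normal_forms_def stable_act_def Let_def cancels_def)
  qed
qed

text \<open>A syllable that was appended is removed again.  Conversely, if a syllable was removed, it is
  appended again rather than a further one removed, since the normal form was reduced.\<close>

lemma stable_act_inverse:
  assumes "\<omega> \<in> normal_forms"
  shows "stable_act (\<not> e) (stable_act e \<omega>) = \<omega>"
proof -
  obtain l g where \<omega>: "\<omega> = (l, g)" by (cases \<omega>)
  then have lg: "reduced l" "g \<in> carrier G" using assms by (auto simp: normal_forms_def)
  define t where "t = rep e g"
  define s where "s = \<theta> e (inv t \<otimes> g)"
  have t: "t \<in> carrier G" "inv t \<otimes> g \<in> assoc_sub e" using rep_props[OF lg(2)] by (auto simp: t_def)
  have s: "s \<in> assoc_sub (\<not> e)" "s \<in> carrier G" "\<theta> (\<not> e) s = inv t \<otimes> g"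
    using \<theta>_closed[OF t(2)] \<theta>_\<theta>[OF t(2)] assoc_sub_closed by (auto simp: s_def)
  show ?thesis
  proof (cases "cancels e \<omega>")
    case False
    then have *: "stable_act e \<omega> = ((t, e) # l, s)" by (simp add: stable_act_def Let_def \<omega> t_def s_def)
    have "t \<otimes> (inv t \<otimes> g) = g" using t(1) lg(2) by (simp add: m_assoc[symmetric])
    then show ?thesis unfolding * using s rep_sub[OF s(1)] \<omega>
      by (simp add: stable_act_def Let_def cancels_def)
  next
    case True
    then obtain t' l' where l: "l = (t', \<not> e) # l'" and t1: "t = \<one>"
      by (cases l) (auto simp: cancels_def \<omega> t_def)
    have *: "stable_act e \<omega> = (l', t' \<otimes> s)" using True l by (simp add: stable_act_def Let_def \<omega> t_def s_def)
    have t': "t' \<in> carrier G" "rep (\<not> e) t' = t'" using lg(1) l by auto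
    have "rep (\<not> e) (t' \<otimes> s) = t'" using rep_mult[OF t'(1) s(1)] t'(2) by simp
    moreover have "inv t' \<otimes> (t' \<otimes> s) = s" using t' s by (simp add: m_assoc[symmetric])
    moreover have "\<theta> (\<not> e) s = g" using s(3) t1 lg(2) by simp
    moreover have "\<not> cancels (\<not> e) (l', t' \<otimes> s)"
      using lg(1) l \<open>rep (\<not> e) (t' \<otimes> s) = t'\<close> by (cases l') (auto simp: cancels_def)
    ultimately show ?thesis unfolding * by (simp add: stable_act_def Let_def \<omega> l)
  qed
qed

text \<open>The defining relation of the extension, as an identity between actions on normal forms.\<close>

lemma stable_act_slide:
  assumes "\<omega> \<in> normal_forms" "s \<in> assoc_sub e"
  shows "stable_act e (base_act s \<omega>) = base_act (\<theta> e s) (stable_act e \<omega>)"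
proof -
  obtain l g where \<omega>: "\<omega> = (l, g)" by (cases \<omega>)
  then have lg: "reduced l" "g \<in> carrier G" using assms by (auto simp: normal_forms_def)
  have r: "rep e (g \<otimes> s) = rep e g" by (rule rep_mult[OF lg(2) assms(2)])
  have t: "rep e g \<in> carrier G" "inv (rep e g) \<otimes> g \<in> assoc_sub e" using rep_props[OF lg(2)] by auto
  have sc: "s \<in> carrier G" using assms assoc_sub_closed by blast
  have "inv (rep e g) \<otimes> (g \<otimes> s) = (inv (rep e g) \<otimes> g) \<otimes> s" using t lg sc by (simp add: m_assoc)
  then have th: "\<theta> e (inv (rep e g) \<otimes> (g \<otimes> s)) = \<theta> e (inv (rep e g) \<otimes> g) \<otimes> \<theta> e s"
    using \<theta>_mult[OF t(2) assms(2)] by simp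
  have c: "cancels e (l, g \<otimes> s) \<longleftrightarrow> cancels e (l, g)" by (simp add: cancels_def r)
  have cl: "\<theta> e (inv (rep e g) \<otimes> g) \<in> carrier G" "\<theta> e s \<in> carrier G"
    using \<theta>_closed t(2) assms(2) assoc_sub_closed by blast+
  have hd: "fst (hd l) \<in> carrier G" if "cancels e (l, g)"
    using that lg(1) by (cases l) (auto simp: cancels_def)
  show ?thesis
  proof (cases "cancels e (l, g)")
    case True
    then show ?thesis using cl hd by (simp add: \<omega> stable_act_def Let_def r c th m_assoc)
  next
    case False
    then show ?thesis by (simp add: \<omega> stable_act_def Let_def r c th)
  qed
qed

fun letter_act :: "'a hnn_gen \<times> bool \<Rightarrow> 'a vertex \<times> 'a \<Rightarrow> 'a vertex \<times> 'a" where
  "letter_act (Base h, b) = base_act (if b then h else inv h)"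
| "letter_act (Stable, b) = stable_act b"

lemma letter_act_closed: "\<omega> \<in> normal_forms \<Longrightarrow> fst a \<in> hnn_gens G \<Longrightarrow> letter_act a \<omega> \<in> normal_forms"
  by (cases a rule: letter_act.cases) (auto simp: hnn_gens_def base_act_closed stable_act_closed)

lemma letter_act_inverse:
  "\<omega> \<in> normal_forms \<Longrightarrow> x \<in> hnn_gens G \<Longrightarrow> letter_act (x, \<not> b) (letter_act (x, b) \<omega>) = \<omega>"
  by (cases x) (auto simp: hnn_gens_def stable_act_inverse base_act_mult base_act_one)

definition word_act :: "'a hnn_gen gword \<Rightarrow> 'a vertex \<times> 'a \<Rightarrow> 'a vertex \<times> 'a" where
  "word_act w = fold letter_act w"

lemma word_act_simps [simp]:
  "word_act [] \<omega> = \<omega>" "word_act (a # w) \<omega> = word_act w (letter_act a \<omega>)"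
  "word_act (u @ v) \<omega> = word_act v (word_act u \<omega>)"
  by (simp_all add: word_act_def)

lemma word_act_closed: "w \<in> gwords (hnn_gens G) \<Longrightarrow> \<omega> \<in> normal_forms \<Longrightarrow> word_act w \<omega> \<in> normal_forms"
  by (induction w arbitrary: \<omega>) (auto simp: letter_act_closed)

lemma word_act_relation:
  assumes "(u, v) \<in> hnn_rels G A \<phi>" "\<omega> \<in> normal_forms"
  shows "word_act u \<omega> = word_act v \<omega>"
proof -
  from assms(1) consider
    (mult) g h where "g \<in> carrier G" "h \<in> carrier G" "u = [(Base g, True), (Base h, True)]"
      "v = [(Base (g \<otimes> h), True)]"
  | (stable) a where "a \<in> A" "u = [(Stable, True), (Base a, True), (Stable, False)]" "v = [(Base (\<phi> a), True)]"
    by (auto simp: hnn_rels_def)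
  then show ?thesis
  proof cases
    case mult
    then show ?thesis using assms(2) by (simp add: base_act_mult)
  next
    case stable
    have s: "\<phi> a \<in> assoc_sub True" and th: "\<theta> True (\<phi> a) = a"
      using stable(1) \<phi>_inj by (auto simp: assoc_sub_def \<theta>_def)
    have "base_act a (stable_act True \<omega>) = stable_act True (base_act (\<phi> a) \<omega>)"
      using stable_act_slide[OF assms(2) s] th by simp
    then show ?thesis
      using stable stable_act_inverse[of "base_act (\<phi> a) \<omega>" True] base_act_closed[OF assms(2)]
        assoc_sub_closed[OF s] by simp
  qed
qed

text \<open>The device of van der Waerden: equivalent words act in the same way on normal forms, so the
  normal form obtained from the empty one depends only on the group element.\<close>

lemma word_act_cong:
  "pres_eq (hnn_gens G) (hnn_rels G A \<phi>) u v \<Longrightarrow> \<omega> \<in> normal_forms \<Longrightarrow> word_act u \<omega> = word_act v \<omega>"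
proof (induction arbitrary: \<omega> rule: pres_eq.induct)
  case (cancel p q x b)
  then show ?case using letter_act_inverse[of "word_act p \<omega>" x b] word_act_closed by simp
next
  case (relation p q u v)
  then show ?case using word_act_relation[of u v "word_act p \<omega>"] word_act_closed by simp
qed auto

abbreviation H :: "'a hnn_gen gword set monoid" where
  "H \<equiv> HNN_extension G A \<phi>"

abbreviation cls :: "'a hnn_gen gword \<Rightarrow> 'a hnn_gen gword set" where
  "cls \<equiv> word_class (hnn_gens G) (hnn_rels G A \<phi>)"

sublocale H: group H
  unfolding HNN_extension_def by (rule group_presented_group)

lemma carrier_H: "carrier H = cls ` gwords (hnn_gens G)"
  unfolding HNN_extension_def by (rule carrier_presented_group)

lemma mult_H: "u \<in> gwords (hnn_gens G) \<Longrightarrow> v \<in> gwords (hnn_gens G) \<Longrightarrow> cls u \<otimes>\<^bsub>H\<^esub> cls v = cls (u @ v)"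
  unfolding HNN_extension_def by (rule mult_presented_group)

lemma one_H: "\<one>\<^bsub>H\<^esub> = cls []"
  unfolding HNN_extension_def by (rule one_presented_group)

definition \<iota> :: "'a \<Rightarrow> 'a hnn_gen gword set" where
  "\<iota> g = cls [(Base g, True)]"

definition stable :: "bool \<Rightarrow> 'a hnn_gen gword set" where
  "stable e = cls [(Stable, e)]"

lemma Base_gens [simp]: "Base g \<in> hnn_gens G \<longleftrightarrow> g \<in> carrier G" and Stable_gens [simp]: "Stable \<in> hnn_gens G"
  by (auto simp: hnn_gens_def)

lemma \<iota>_closed: "g \<in> carrier G \<Longrightarrow> \<iota> g \<in> carrier H"
  by (auto simp: carrier_H \<iota>_def)

lemma stable_closed: "stable e \<in> carrier H"
  by (auto simp: carrier_H stable_def)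

lemma letter_inverse:
  assumes "x \<in> hnn_gens G"
  shows "cls [(x, \<not> b)] = inv\<^bsub>H\<^esub> (cls [(x, b)])"
proof -
  have "cls [(x, \<not> b), (x, b)] = cls []"
    using pres_eq.cancel[of "[]" "hnn_gens G" "[]" x "hnn_rels G A \<phi>" "\<not> b"] assms
    by (intro word_class_eq) simp
  then have "cls [(x, \<not> b)] \<otimes>\<^bsub>H\<^esub> cls [(x, b)] = \<one>\<^bsub>H\<^esub>"
    using assms by (simp add: mult_H one_H)
  moreover have "cls [(x, b)] \<in> carrier H" "cls [(x, \<not> b)] \<in> carrier H"
    using assms by (auto simp: carrier_H)
  ultimately show ?thesis using H.inv_equality by metis
qed

lemma stable_inverse: "stable (\<not> e) = inv\<^bsub>H\<^esub> (stable e)"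
  by (simp add: stable_def letter_inverse)

lemma \<iota>_mult:
  assumes "g \<in> carrier G" "h \<in> carrier G"
  shows "\<iota> (g \<otimes> h) = \<iota> g \<otimes>\<^bsub>H\<^esub> \<iota> h"
proof -
  have "cls ([] @ [(Base g, True), (Base h, True)] @ []) = cls ([] @ [(Base (g \<otimes> h), True)] @ [])"
    by (intro word_class_eq pres_eq.relation) (use assms in \<open>auto simp: hnn_rels_def\<close>)
  then show ?thesis using assms by (simp add: \<iota>_def mult_H)
qed

sublocale \<iota>: group_hom G H \<iota>
  by unfold_locales (auto simp: hom_def \<iota>_closed \<iota>_mult)

text \<open>The relation \<open>y a y\<^sup>-\<^sup>1 = \<phi> a\<close>, solved for both signs.\<close>

lemma stable_slide:
  assumes "s \<in> assoc_sub e"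
  shows "\<iota> s \<otimes>\<^bsub>H\<^esub> stable e = stable e \<otimes>\<^bsub>H\<^esub> \<iota> (\<theta> e s)"
proof -
  have rel: "stable True \<otimes>\<^bsub>H\<^esub> \<iota> a \<otimes>\<^bsub>H\<^esub> stable False = \<iota> (\<phi> a)" if "a \<in> A" for a
  proof -
    have c: "a \<in> carrier G" "\<phi> a \<in> carrier G"
      using that subgroup.subset[OF A] assoc_sub_closed[of "\<phi> a" True] by (auto simp: assoc_sub_def)
    have "cls ([] @ [(Stable, True), (Base a, True), (Stable, False)] @ []) = cls ([] @ [(Base (\<phi> a), True)] @ [])"
      by (intro word_class_eq pres_eq.relation) (use that c in \<open>auto simp: hnn_rels_def\<close>)
    then show ?thesis using c by (simp add: \<iota>_def stable_def mult_H)
  qed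
  have inv: "stable False = inv\<^bsub>H\<^esub> (stable True)" using stable_inverse[of True] by simp
  let ?y = "stable True"
  have y: "?y \<in> carrier H" by (rule stable_closed)
  show ?thesis
  proof (cases e)
    case True
    then obtain a where a: "a \<in> A" "s = \<phi> a" using assms by (auto simp: assoc_sub_def)
    have c: "\<iota> a \<in> carrier H" using subgroup.mem_carrier[OF A a(1)] by (rule \<iota>_closed)
    have "\<iota> s \<otimes>\<^bsub>H\<^esub> ?y = ?y \<otimes>\<^bsub>H\<^esub> \<iota> a \<otimes>\<^bsub>H\<^esub> inv\<^bsub>H\<^esub> ?y \<otimes>\<^bsub>H\<^esub> ?y"
      using rel[OF a(1)] a(2) inv by simp
    also have "\<dots> = ?y \<otimes>\<^bsub>H\<^esub> \<iota> a" using c y by (simp add: H.m_assoc)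
    finally show ?thesis using True a \<phi>_inj by (simp add: \<theta>_def)
  next
    case False
    then have a: "s \<in> A" using assms by (auto simp: assoc_sub_def)
    have c: "\<iota> s \<in> carrier H" using subgroup.mem_carrier[OF A a] by (rule \<iota>_closed)
    have "inv\<^bsub>H\<^esub> ?y \<otimes>\<^bsub>H\<^esub> \<iota> (\<phi> s) = inv\<^bsub>H\<^esub> ?y \<otimes>\<^bsub>H\<^esub> (?y \<otimes>\<^bsub>H\<^esub> \<iota> s \<otimes>\<^bsub>H\<^esub> inv\<^bsub>H\<^esub> ?y)"
      using rel[OF a] inv by simp
    also have "\<dots> = (inv\<^bsub>H\<^esub> ?y \<otimes>\<^bsub>H\<^esub> ?y) \<otimes>\<^bsub>H\<^esub> (\<iota> s \<otimes>\<^bsub>H\<^esub> inv\<^bsub>H\<^esub> ?y)"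
      using c y by (simp only: H.m_assoc H.m_closed H.inv_closed)
    also have "\<dots> = \<iota> s \<otimes>\<^bsub>H\<^esub> inv\<^bsub>H\<^esub> ?y" using c y by simp
    finally show ?thesis using False inv by (simp add: \<theta>_def)
  qed
qed

fun path_value :: "'a vertex \<Rightarrow> 'a hnn_gen gword set" where
  "path_value [] = \<one>\<^bsub>H\<^esub>"
| "path_value ((t, e) # l) = path_value l \<otimes>\<^bsub>H\<^esub> \<iota> t \<otimes>\<^bsub>H\<^esub> stable e"

definition nf_value :: "'a vertex \<times> 'a \<Rightarrow> 'a hnn_gen gword set" where
  "nf_value \<omega> = path_value (fst \<omega>) \<otimes>\<^bsub>H\<^esub> \<iota> (snd \<omega>)"

lemma path_value_closed: "reduced l \<Longrightarrow> path_value l \<in> carrier H"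
  by (induction l rule: path_value.induct) (auto simp: stable_closed)

lemma nf_value_base:
  "\<omega> \<in> normal_forms \<Longrightarrow> h \<in> carrier G \<Longrightarrow> nf_value (base_act h \<omega>) = nf_value \<omega> \<otimes>\<^bsub>H\<^esub> \<iota> h"
  by (cases \<omega>) (auto simp: normal_forms_def nf_value_def path_value_closed H.m_assoc)

text \<open>The steps of the definition of \<open>stable_act\<close> are valid in the extension.\<close>

lemma nf_value_stable:
  assumes "\<omega> \<in> normal_forms"
  shows "nf_value (stable_act e \<omega>) = nf_value \<omega> \<otimes>\<^bsub>H\<^esub> stable e"
proof -
  obtain l g where \<omega>: "\<omega> = (l, g)" by (cases \<omega>)
  then have lg: "reduced l" "g \<in> carrier G" using assms by (auto simp: normal_forms_def)
  define t where "t = rep e g"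
  define s where "s = inv t \<otimes> g"
  have t: "t \<in> carrier G" and s: "s \<in> assoc_sub e" using rep_props[OF lg(2)] by (auto simp: t_def s_def)
  have sc: "s \<in> carrier G" "\<theta> e s \<in> carrier G" using s \<theta>_closed assoc_sub_closed by blast+
  have "g = t \<otimes> s" using t lg(2) by (simp add: s_def m_assoc[symmetric])
  then have "nf_value \<omega> \<otimes>\<^bsub>H\<^esub> stable e = path_value l \<otimes>\<^bsub>H\<^esub> \<iota> t \<otimes>\<^bsub>H\<^esub> (\<iota> s \<otimes>\<^bsub>H\<^esub> stable e)"
    using t sc path_value_closed[OF lg(1)] by (simp add: \<omega> nf_value_def H.m_assoc stable_closed)
  also have "\<dots> = path_value l \<otimes>\<^bsub>H\<^esub> \<iota> t \<otimes>\<^bsub>H\<^esub> stable e \<otimes>\<^bsub>H\<^esub> \<iota> (\<theta> e s)"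
    using t sc path_value_closed[OF lg(1)] by (simp add: stable_slide[OF s] H.m_assoc stable_closed)
  also have "\<dots> = nf_value (stable_act e \<omega>)"
  proof (cases "cancels e \<omega>")
    case False
    then show ?thesis by (simp add: nf_value_def stable_act_def Let_def \<omega> t_def s_def)
  next
    case True
    then obtain t' l' where l: "l = (t', \<not> e) # l'" and t1: "t = \<one>"
      by (cases l) (auto simp: cancels_def \<omega> t_def)
    have c: "t' \<in> carrier G" "path_value l' \<in> carrier H" using lg(1) l path_value_closed by auto
    have "path_value l \<otimes>\<^bsub>H\<^esub> \<iota> t \<otimes>\<^bsub>H\<^esub> stable e = path_value l' \<otimes>\<^bsub>H\<^esub> \<iota> t'"
      using c by (simp add: l t1 stable_inverse stable_closed H.m_assoc)
    moreover have "stable_act e \<omega> = (l', t' \<otimes> \<theta> e s)"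
      using True l by (simp add: stable_act_def Let_def \<omega> t_def s_def)
    ultimately show ?thesis using c sc by (simp add: nf_value_def H.m_assoc)
  qed
  finally show ?thesis by simp
qed

lemma nf_value_word_act:
  "w \<in> gwords (hnn_gens G) \<Longrightarrow> \<omega> \<in> normal_forms \<Longrightarrow> nf_value (word_act w \<omega>) = nf_value \<omega> \<otimes>\<^bsub>H\<^esub> cls w"
proof (induction w arbitrary: \<omega>)
  case Nil
  then show ?case
    by (cases \<omega>) (simp add: one_H[symmetric] nf_value_def normal_forms_def path_value_closed)
next
  case (Cons a w)
  have a: "fst a \<in> hnn_gens G" and w: "w \<in> gwords (hnn_gens G)" using Cons.prems by auto
  have "nf_value (letter_act a \<omega>) = nf_value \<omega> \<otimes>\<^bsub>H\<^esub> cls [a]"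
  proof (cases a rule: letter_act.cases)
    case (1 h b)
    then have h: "h \<in> carrier G" using a by simp
    then have "cls [(Base h, False)] = \<iota> (inv h)"
      using letter_inverse[of "Base h" True] by (simp add: \<iota>_def[symmetric])
    then show ?thesis using 1 h Cons.prems nf_value_base by (cases b) (auto simp: \<iota>_def[symmetric])
  next
    case (2 b)
    then show ?thesis using Cons.prems nf_value_stable by (simp add: stable_def)
  qed
  moreover have "nf_value \<omega> \<in> carrier H"
    using Cons.prems(2) path_value_closed by (cases \<omega>) (auto simp: normal_forms_def nf_value_def)
  moreover have "cls (a # w) = cls [a] \<otimes>\<^bsub>H\<^esub> cls w" using a w by (simp add: mult_H)
  moreover have "cls [a] \<in> carrier H" "cls w \<in> carrier H" using a w by (auto simp: carrier_H)
  ultimately show ?case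
    using Cons.IH[OF w letter_act_closed[OF Cons.prems(2) a]] by (simp add: H.m_assoc)
qed

definition nf :: "'a hnn_gen gword set \<Rightarrow> 'a vertex \<times> 'a" where
  "nf U = word_act (SOME w. w \<in> U) ([], \<one>)"

lemma start_normal: "([], \<one>) \<in> normal_forms"
  by (simp add: normal_forms_def)

lemma nf_cls:
  assumes "w \<in> gwords (hnn_gens G)"
  shows "nf (cls w) = word_act w ([], \<one>)"
proof -
  have "w \<in> cls w" using pres_eq.refl[OF assms] by (simp add: pres_rel_def)
  then have "(SOME v. v \<in> cls w) \<in> cls w" by (rule someI)
  then show ?thesis unfolding nf_def using word_act_cong start_normal by (simp add: pres_rel_def)
qed

lemma nf_normal: "U \<in> carrier H \<Longrightarrow> nf U \<in> normal_forms"
  by (auto simp: carrier_H nf_cls word_act_closed start_normal)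

text \<open>The normal form of an element determines the element, and so the vertex determines its coset
  of \<open>G\<close>.\<close>

lemma nf_value_nf: "U \<in> carrier H \<Longrightarrow> nf_value (nf U) = U"
proof -
  assume U: "U \<in> carrier H"
  have "nf_value ([], \<one>) = \<one>\<^bsub>H\<^esub>" by (simp add: nf_value_def)
  then show ?thesis using U nf_value_word_act[OF _ start_normal]
    by (auto simp: carrier_H nf_cls)
qed

lemma nf_step:
  assumes "U \<in> carrier H" "fst a \<in> hnn_gens G"
  shows "nf (U \<otimes>\<^bsub>H\<^esub> cls [a]) = letter_act a (nf U)"
  using assms by (auto simp: carrier_H mult_H nf_cls)

lemma nf_\<iota>: "g \<in> carrier G \<Longrightarrow> nf (\<iota> g) = ([], g)"
  by (simp add: \<iota>_def nf_cls)

text \<open>The base group embeds: the normal form of \<open>\<iota> g\<close> is the empty list with remainder \<open>g\<close>.\<close>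

lemma \<iota>_inj: "inj_on \<iota> (carrier G)"
  by (rule inj_onI) (metis nf_\<iota> snd_conv)

definition vertex :: "'a hnn_gen gword set \<Rightarrow> 'a vertex" where
  "vertex U = rev (fst (nf U))"

lemma vertex_base: "U \<in> carrier H \<Longrightarrow> g \<in> carrier G \<Longrightarrow> vertex (U \<otimes>\<^bsub>H\<^esub> \<iota> g) = vertex U"
  by (cases "nf U") (simp add: vertex_def \<iota>_def nf_step)

lemma vertex_stable: "U \<in> carrier H \<Longrightarrow> adjacent (vertex U) (vertex (U \<otimes>\<^bsub>H\<^esub> stable e))"
  by (cases "fst (nf U)")
    (auto simp: vertex_def stable_def nf_step stable_act_def Let_def cancels_def adjacent_def)

lemma vertex_fibre:
  assumes "U \<in> carrier H" "V \<in> carrier H" "vertex U = vertex V"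
  shows "inv\<^bsub>H\<^esub> U \<otimes>\<^bsub>H\<^esub> V \<in> \<iota> ` carrier G"
proof -
  obtain l g where U: "nf U = (l, g)" by (cases "nf U")
  obtain g' where V: "nf V = (l, g')" using assms(3) U by (cases "nf V") (auto simp: vertex_def)
  have c: "reduced l" "g \<in> carrier G" "g' \<in> carrier G"
    using nf_normal[OF assms(1)] nf_normal[OF assms(2)] U V by (auto simp: normal_forms_def)
  note p = path_value_closed[OF c(1)]
  have "U = path_value l \<otimes>\<^bsub>H\<^esub> \<iota> g" "V = path_value l \<otimes>\<^bsub>H\<^esub> \<iota> g'"
    using nf_value_nf[OF assms(1)] nf_value_nf[OF assms(2)] U V by (auto simp: nf_value_def)
  then have "inv\<^bsub>H\<^esub> U \<otimes>\<^bsub>H\<^esub> V = inv\<^bsub>H\<^esub> (\<iota> g) \<otimes>\<^bsub>H\<^esub> (inv\<^bsub>H\<^esub> (path_value l) \<otimes>\<^bsub>H\<^esub> path_value l) \<otimes>\<^bsub>H\<^esub> \<iota> g'"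
    using c p by (simp only: H.inv_mult_group H.m_assoc H.m_closed H.inv_closed \<iota>_closed)
  also have "\<dots> = \<iota> (inv g \<otimes> g')" using c p by simp
  finally have "inv\<^bsub>H\<^esub> U \<otimes>\<^bsub>H\<^esub> V = \<iota> (inv g \<otimes> g')" .
  then show ?thesis using c by (metis image_eqI inv_closed m_closed)
qed

text \<open>After removal of the remainder \<open>g\<close>, the last stable letter can be cancelled.\<close>

lemma vertex_parent:
  assumes "U \<in> carrier H" "vertex U = u @ [a]"
  shows "\<exists>k\<in>\<iota> ` carrier G. \<exists>s\<in>{stable True, inv\<^bsub>H\<^esub> (stable True)}. vertex (U \<otimes>\<^bsub>H\<^esub> k \<otimes>\<^bsub>H\<^esub> s) = u"
proof -
  obtain t e where a: "a = (t, e)" by (cases a)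
  obtain g where U: "nf U = ((t, e) # rev u, g)"
    using assms(2) a by (cases "nf U") (auto simp: vertex_def rev_swap)
  have g: "g \<in> carrier G" using nf_normal[OF assms(1)] U by (simp add: normal_forms_def)
  let ?k = "\<iota> (inv g)"
  have k: "U \<otimes>\<^bsub>H\<^esub> ?k \<in> carrier H" using assms(1) g by simp
  have "nf (U \<otimes>\<^bsub>H\<^esub> ?k) = ((t, e) # rev u, \<one>)"
    using nf_step[OF assms(1), of "(Base (inv g), True)"] U g by (simp add: \<iota>_def)
  then have "nf (U \<otimes>\<^bsub>H\<^esub> ?k \<otimes>\<^bsub>H\<^esub> stable (\<not> e)) = stable_act (\<not> e) ((t, e) # rev u, \<one>)"
    using nf_step[OF k, of "(Stable, \<not> e)"] by (simp add: stable_def)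
  then have "vertex (U \<otimes>\<^bsub>H\<^esub> ?k \<otimes>\<^bsub>H\<^esub> stable (\<not> e)) = u"
    using rep_sub[OF subgroup.one_closed[OF assoc_sub_subgroup]]
    by (simp add: vertex_def stable_act_def Let_def cancels_def)
  moreover have "stable (\<not> e) \<in> {stable True, inv\<^bsub>H\<^esub> (stable True)}"
    using stable_inverse[of True] by (cases e) auto
  moreover have "?k \<in> \<iota> ` carrier G" using g by blast
  ultimately show ?thesis by blast
qed

lemma generating_set:
  assumes "finite_generating_set G S"
  shows "finite_generating_set H (insert (stable True) (\<iota> ` S))"
proof -
  let ?T = "insert (stable True) (\<iota> ` S)"
  have S: "finite S" "S \<subseteq> carrier G" "generate G S = carrier G"
    using assms by (auto simp: finite_generating_set_def)
  have T: "?T \<subseteq> carrier H" using S(2) stable_closed by auto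
  have base: "\<iota> g \<in> generate H ?T" if "g \<in> carrier G" for g
  proof -
    have "\<iota> g \<in> generate H (\<iota> ` S)" using \<iota>.generate_img[OF S(2)] S(3) that by blast
    then show ?thesis using H.mono_generate[of "\<iota> ` S" ?T] by blast
  qed
  have st: "stable b \<in> generate H ?T" for b
    using generate.incl[of "stable True" ?T H] generate.inv[of "stable True" ?T H] stable_inverse[of True]
    by (cases b) auto
  have "cls w \<in> generate H ?T" if "w \<in> gwords (hnn_gens G)" for w
    using that
  proof (induction w)
    case Nil
    then show ?case using generate.one[of H ?T] by (simp add: one_H)
  next
    case (Cons a w)
    have "cls [a] \<in> generate H ?T"
    proof (cases a rule: letter_act.cases)
      case (1 h b)
      then have h: "h \<in> carrier G" using Cons.prems by simp
      then have "cls [(Base h, False)] = \<iota> (inv h)"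
        using letter_inverse[of "Base h" True] by (simp add: \<iota>_def[symmetric])
      then show ?thesis using 1 h base[of h] base[of "inv h"] by (cases b) (auto simp: \<iota>_def)
    next
      case (2 b)
      then show ?thesis using st by (simp add: stable_def)
    qed
    then have "cls [a] \<otimes>\<^bsub>H\<^esub> cls w \<in> generate H ?T" using Cons by (intro generate.eng) auto
    then show ?case using Cons.prems by (simp add: mult_H)
  qed
  then have "carrier H \<subseteq> generate H ?T" by (auto simp: carrier_H)
  then show ?thesis
    using S(1) T H.generate_incl[OF T] by (auto simp: finite_generating_set_def)
qed

end

section \<open>The dimension of an HNN extension\<close>

theorem theorem7:
  fixes G :: "('a, 'b) monoid_scheme"
    and A S :: "'a set"
    and \<phi> :: "'a \<Rightarrow> 'a"
    and n :: nat
  assumes "group G"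
    and "finite_generating_set G S"
    and "asdim_le (carrier G) (word_metric G S) n"
    and "subgroup A G"
    and "\<phi> \<in> mon (G\<lparr>carrier := A\<rparr>) G"
  shows "(\<exists>T. finite_generating_set (HNN_extension G A \<phi>) T) \<and>
         (\<forall>T. finite_generating_set (HNN_extension G A \<phi>) T \<longrightarrow>
              asdim_le (carrier (HNN_extension G A \<phi>)) (word_metric (HNN_extension G A \<phi>) T) (2 * n + 1))"
proof -
  interpret hnn G A \<phi> using assms by (simp add: hnn_def hnn_axioms_def)
  let ?T = "insert (stable True) (\<iota> ` S)"
  have T: "finite_generating_set H ?T" by (rule generating_set[OF assms(2)])
  have S: "S \<subseteq> carrier G" using assms(2) by (simp add: finite_generating_set_def)
  interpret tree: group_on_tree H "\<iota> ` carrier G" "stable True" ?T vertex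
  proof (rule group_on_tree.intro[OF H.is_group group_on_tree_axioms.intro])
    show "subgroup (\<iota> ` carrier G) H" by (rule \<iota>.img_is_subgroup)
    show "vertex \<one>\<^bsub>H\<^esub> = []" using nf_cls[of "[]"] by (simp add: one_H vertex_def)
  qed (use T S stable_closed vertex_base vertex_stable vertex_fibre vertex_parent in auto)
  have "colourable (word_metric H ?T) (\<iota> ` carrier G) n r" for r
    by (rule colourable_subgroup[OF assms(1) H.is_group assms(2) T \<iota>.homh \<iota>_inj])
      (rule colourable_if_asdim_le[OF assms(3)])
  then have tree: "colourable (word_metric H ?T) (carrier H) (2 * n + 1) r" for r
    by (rule tree.colourable_tree)
  have "asdim_le (carrier H) (word_metric H T') (2 * n + 1)" if T': "finite_generating_set H T'" for T'
  proof (rule asdim_le_if_colourable)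
    fix x y assume "x \<in> carrier H" "y \<in> carrier H"
    then show "word_metric H T' x y = word_metric H T' y x"
      by (rule pseudometric.commute[OF H.word_metric_pseudometric[OF T']])
  next
    fix r
    \<comment> \<open>The identity is a coarse equivalence between the metrics of \<open>?T\<close> and \<open>T'\<close>.\<close>
    have "id \<in> hom H H" by (auto simp: hom_def)
    then have "colourable (word_metric H T') (id ` carrier H) (2 * n + 1) r"
      by (rule colourable_subgroup[OF H.is_group H.is_group T T' _ _ tree]) simp
    then show "colourable (word_metric H T') (carrier H) (2 * n + 1) r" by simp
  qed
  then show ?thesis using T by blast
qed

end
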